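(* Let $x_1, x_2, \ldots, x_n$ be weakly fully independent self-adjoint random variables in $\mathfrak{M}$ with partial sums $s_k = x_1+\cdots+x_k$ satisfying $s_k s_n = s_n s_k$ for $k=1,2,\ldots,n$. For each $\lambda>0$ and any $0<\alpha<1$, if $$M_{\lambda}:= \frac{1}{\min\limits_{1 \leq k\leq n} \tau\left(e_{-(1-\alpha)\lambda}^{\perp}\left(s_n - s_k \right) \right)}$$ (with $1/0=\infty$), then there exists a projection $p$ in $\mathfrak{M}$ such that $$\max_{1 \leq k \leq n} \frac{1}{2^{k-1}}\, \tau \left( e_{(\lambda, \infty)}(s_k) \right) \leq \tau(p) \leq M_{\lambda}\, \tau \left( e_{(\alpha \lambda, \infty)}( s_n ) \right),$$ where, if $M_\lambda=\infty$, the right-hand side is read as $+\infty$.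
   Context: $\mathfrak{M}$ is a von Neumann algebra on a Hilbert space with unit $\mathbf{1}$, equipped with a normal faithful tracial state $\tau$; its elements are called random variables. For self-adjoint $x\in\mathfrak{M}$ and a Borel set $B\subseteq\mathbb{R}$, $e_B(x)$ is the spectral projection of $x$ corresponding to $B$; for $t\in\mathbb{R}$, $e_t(x)=e_{(-\infty,t)}(x)$ and $e_t^{\perp}(x)=\mathbf{1}-e_t(x)=e_{[t,\infty)}(x)$. For $S\subseteq \mathfrak{M}$, $W^*(S)$ is the von Neumann subalgebra generated by $S$. A sequence $(x_k)_{k=1}^n$ in $\mathfrak{M}$ is weakly fully independent if for every $1<j\leq n$ one has $\tau(ab)=\tau(a)\tau(b)$ for all $a\in W^*(x_1,\ldots,x_{j-1})$ and $b\in W^*(x_j,\ldots,x_n)$. *)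

theory Defs
  imports "HOL-Analysis.Analysis"
begin

section \<open>Complex Hilbert spaces\<close>

text \<open>
  The inner product is conjugate linear in the first argument. The underlying real Hilbert space
  carries the real part of \<open>cinner\<close>, so that the norm is the one induced by \<open>cinner\<close>.
\<close>

class complex_hilbert_space = real_inner + complete_space +
  fixes scaleC :: "complex \<Rightarrow> 'a \<Rightarrow> 'a"  (infixr \<open>*\<^sub>C\<close> 75)
    and cinner :: "'a \<Rightarrow> 'a \<Rightarrow> complex"
  assumes scaleC_add_right: "c *\<^sub>C (u + v) = c *\<^sub>C u + c *\<^sub>C v"
    and scaleC_add_left: "(c + d) *\<^sub>C v = c *\<^sub>C v + d *\<^sub>C v"
    and scaleC_scaleC: "c *\<^sub>C d *\<^sub>C v = (c * d) *\<^sub>C v"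
    and scaleC_of_real: "complex_of_real r *\<^sub>C v = r *\<^sub>R v"
    and cinner_commute: "cinner u v = cnj (cinner v u)"
    and cinner_add_right: "cinner u (v + w) = cinner u v + cinner u w"
    and cinner_scaleC_right: "cinner u (c *\<^sub>C v) = c * cinner u v"
    and Re_cinner: "Re (cinner u v) = inner u v"

lemma norm_scaleC: "norm (c *\<^sub>C (v :: 'h::complex_hilbert_space)) = cmod c * norm v"
proof -
  have self: "cinner v v = complex_of_real (inner v v)" for v :: 'h
    using cinner_commute[of v v] Re_cinner[of v v] by (simp add: complex_eq_iff)
  have "cinner (c *\<^sub>C v) (c *\<^sub>C v) = c * cnj (c * cinner v v)"
    by (metis cinner_commute cinner_scaleC_right)
  also have "\<dots> = complex_of_real ((cmod c)\<^sup>2 * inner v v)"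
    by (simp add: self complex_norm_square[symmetric] flip: mult.assoc)
  finally have "inner (c *\<^sub>C v) (c *\<^sub>C v) = (cmod c)\<^sup>2 * inner v v"
    by (simp add: self del: of_real_mult)
  then show ?thesis
    by (simp add: norm_eq_sqrt_inner real_sqrt_mult)
qed

lemma bounded_linear_scaleC:
  assumes "bounded_linear f"
  shows "bounded_linear (\<lambda>v. c *\<^sub>C (f v :: 'h::complex_hilbert_space))"
proof -
  interpret f: bounded_linear f by fact
  show ?thesis
  proof (rule bounded_linear_intro[where K = "cmod c * onorm f"])
    show "c *\<^sub>C f (u + v) = c *\<^sub>C f u + c *\<^sub>C f v" for u v
      by (simp add: f.add scaleC_add_right)
    show "c *\<^sub>C f (r *\<^sub>R v) = r *\<^sub>R c *\<^sub>C f v" for r v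
      by (simp add: f.scaleR scaleC_scaleC mult.commute flip: scaleC_of_real)
    show "norm (c *\<^sub>C f v) \<le> norm v * (cmod c * onorm f)" for v
      using mult_left_mono[OF onorm[OF assms, of v] norm_ge_zero[of c]]
      by (simp add: norm_scaleC mult_ac)
  qed
qed


section \<open>Bounded operators\<close>

text \<open>
  The library type \<open>'h \<Rightarrow>\<^sub>L 'h\<close> consists of the bounded real-linear maps; the bounded operators
  on the complex Hilbert space \<open>'h\<close> are the complex-linear ones among them.
\<close>

type_synonym 'h oper = "'h \<Rightarrow>\<^sub>L 'h"

definition bounded_operators :: "'h::complex_hilbert_space oper set" where
  "bounded_operators = {a. \<forall>c v. blinfun_apply a (c *\<^sub>C v) = c *\<^sub>C blinfun_apply a v}"

lift_definition scaleC_oper :: "complex \<Rightarrow> 'h::complex_hilbert_space oper \<Rightarrow> 'h oper"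
  is "\<lambda>c f v. c *\<^sub>C f v"
  by (rule bounded_linear_scaleC)

definition cadjoint :: "'h::complex_hilbert_space oper \<Rightarrow> 'h oper" where
  "cadjoint a = (THE b. \<forall>u v. cinner (blinfun_apply b u) v = cinner u (blinfun_apply a v))"

definition selfadjoint :: "'h::complex_hilbert_space oper \<Rightarrow> bool" where
  "selfadjoint a \<longleftrightarrow> a \<in> bounded_operators \<and> cadjoint a = a"

definition projection :: "'h::complex_hilbert_space oper \<Rightarrow> bool" where
  "projection p \<longleftrightarrow> selfadjoint p \<and> p o\<^sub>L p = p"

definition oper_le :: "'h::complex_hilbert_space oper \<Rightarrow> 'h oper \<Rightarrow> bool"  (infix \<open>\<sqsubseteq>\<close> 50) where
  "a \<sqsubseteq> b \<longleftrightarrow> (\<forall>v. cinner v (blinfun_apply (b - a) v) \<in> \<real>\<^sub>\<ge>\<^sub>0)"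


section \<open>Spectral projections\<close>

definition projection_valued_measure :: "(real set \<Rightarrow> 'h::complex_hilbert_space oper) \<Rightarrow> bool" where
  "projection_valued_measure E \<longleftrightarrow>
     (\<forall>B \<in> sets borel. projection (E B)) \<and>
     E UNIV = id_blinfun \<and>
     (\<forall>A \<in> sets borel. \<forall>B \<in> sets borel. E (A \<inter> B) = E A o\<^sub>L E B) \<and>
     (\<forall>A :: nat \<Rightarrow> real set. range A \<subseteq> sets borel \<longrightarrow> disjoint_family A \<longrightarrow>
        (\<forall>v. (\<lambda>i. blinfun_apply (E (A i)) v) sums blinfun_apply (E (\<Union>i. A i)) v))"

definition scalar_measure ::
    "(real set \<Rightarrow> 'h::complex_hilbert_space oper) \<Rightarrow> 'h \<Rightarrow> real measure" where
  "scalar_measure E v =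
     measure_of UNIV (sets borel) (\<lambda>B. ennreal (Re (cinner v (blinfun_apply (E B) v))))"

text \<open>
  \<open>x = \<integral> t dE(t)\<close> in the weak sense, for a boundedly supported \<open>E\<close>; by polarization the
  quadratic form determines \<open>x\<close>.
\<close>

definition spectral_resolution ::
    "'h::complex_hilbert_space oper \<Rightarrow> (real set \<Rightarrow> 'h oper) \<Rightarrow> bool" where
  "spectral_resolution x E \<longleftrightarrow>
     projection_valued_measure E \<and>
     (\<exists>r. E {-r..r} = id_blinfun) \<and>
     (\<forall>v. cinner v (blinfun_apply x v) = complex_of_real (\<integral>t. t \<partial>scalar_measure E v))"

text \<open>
  By the spectral theorem a self-adjoint \<open>x\<close> has a spectral resolution, and it is unique on the
  Borel sets.
\<close>

definition spectral_projection ::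
    "'h::complex_hilbert_space oper \<Rightarrow> real set \<Rightarrow> 'h oper" where
  "spectral_projection x B = (THE p. \<exists>E. spectral_resolution x E \<and> p = E B)"

definition spectral_below :: "real \<Rightarrow> 'h::complex_hilbert_space oper \<Rightarrow> 'h oper" where
  "spectral_below t x = spectral_projection x {..<t}"

definition spectral_below_perp :: "real \<Rightarrow> 'h::complex_hilbert_space oper \<Rightarrow> 'h oper" where
  "spectral_below_perp t x = id_blinfun - spectral_below t x"


section \<open>Von Neumann algebras with a normal faithful tracial state\<close>

locale von_neumann_algebra =
  fixes M :: "'h::complex_hilbert_space oper set"
  assumes subset_bounded_operators: "M \<subseteq> bounded_operators"
    and one_mem: "id_blinfun \<in> M"
    and add_mem: "a \<in> M \<Longrightarrow> b \<in> M \<Longrightarrow> a + b \<in> M"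
    and scaleC_mem: "a \<in> M \<Longrightarrow> scaleC_oper c a \<in> M"
    and mult_mem: "a \<in> M \<Longrightarrow> b \<in> M \<Longrightarrow> a o\<^sub>L b \<in> M"
    and adjoint_mem: "a \<in> M \<Longrightarrow> cadjoint a \<in> M"
    and strongly_closed: "closedin strong_operator_topology M"

definition generated_vna :: "'h::complex_hilbert_space oper set \<Rightarrow> 'h oper set"  (\<open>W*\<close>) where
  "W* S = \<Inter>{N. von_neumann_algebra N \<and> S \<subseteq> N}"

text \<open>
  In the last assumption \<open>D\<close> is an upward directed set of self-adjoint elements (the range of an
  increasing net) and \<open>s\<close> its least upper bound among the self-adjoint elements of \<open>M\<close>.
\<close>

locale tracial_von_neumann_algebra = von_neumann_algebra M
  for M :: "'h::complex_hilbert_space oper set" +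
  fixes \<tau> :: "'h oper \<Rightarrow> complex"
  assumes trace_add: "a \<in> M \<Longrightarrow> b \<in> M \<Longrightarrow> \<tau> (a + b) = \<tau> a + \<tau> b"
    and trace_scaleC: "a \<in> M \<Longrightarrow> \<tau> (scaleC_oper c a) = c * \<tau> a"
    and trace_positive: "a \<in> M \<Longrightarrow> \<tau> (cadjoint a o\<^sub>L a) \<in> \<real>\<^sub>\<ge>\<^sub>0"
    and trace_one: "\<tau> id_blinfun = 1"
    and trace_commute: "a \<in> M \<Longrightarrow> b \<in> M \<Longrightarrow> \<tau> (a o\<^sub>L b) = \<tau> (b o\<^sub>L a)"
    and trace_faithful: "a \<in> M \<Longrightarrow> \<tau> (cadjoint a o\<^sub>L a) = 0 \<Longrightarrow> a = 0"
    and trace_normal: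
      "D \<subseteq> {a \<in> M. selfadjoint a} \<Longrightarrow> D \<noteq> {} \<Longrightarrow>
       (\<And>a b. a \<in> D \<Longrightarrow> b \<in> D \<Longrightarrow> \<exists>c \<in> D. a \<sqsubseteq> c \<and> b \<sqsubseteq> c) \<Longrightarrow>
       s \<in> M \<Longrightarrow> selfadjoint s \<Longrightarrow> (\<And>a. a \<in> D \<Longrightarrow> a \<sqsubseteq> s) \<Longrightarrow>
       (\<And>b. b \<in> M \<Longrightarrow> selfadjoint b \<Longrightarrow> (\<And>a. a \<in> D \<Longrightarrow> a \<sqsubseteq> b) \<Longrightarrow> s \<sqsubseteq> b) \<Longrightarrow>
       Re (\<tau> s) = (SUP a \<in> D. Re (\<tau> a))"

definition weakly_fully_independent ::
    "('h::complex_hilbert_space oper \<Rightarrow> complex) \<Rightarrow> nat \<Rightarrow> (nat \<Rightarrow> 'h oper) \<Rightarrow> bool" where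
  "weakly_fully_independent \<tau> n x \<longleftrightarrow>
     (\<forall>j. 1 < j \<and> j \<le> n \<longrightarrow>
        (\<forall>a \<in> W* (x ` {1..j - 1}). \<forall>b \<in> W* (x ` {j..n}). \<tau> (a o\<^sub>L b) = \<tau> a * \<tau> b))"

definition partial_sum :: "(nat \<Rightarrow> 'h::complex_hilbert_space oper) \<Rightarrow> nat \<Rightarrow> 'h oper" where
  "partial_sum x k = (\<Sum>i = 1..k. x i)"

text \<open>
  In \<^typ>\<open>ereal\<close>, division gives \<open>1 / 0 = \<infinity>\<close>. The minimum runs over \<open>1 \<le> k \<le> n\<close>, so \<open>n \<ge> 1\<close> is
  presupposed. The trace of a projection is a real number, whence the harmless \<^const>\<open>Re\<close>.
\<close>

definition M_const ::
    "('h::complex_hilbert_space oper \<Rightarrow> complex) \<Rightarrow> nat \<Rightarrow> (nat \<Rightarrow> 'h oper) \<Rightarrow> real \<Rightarrow> real \<Rightarrow> ereal"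
  where
  "M_const \<tau> n x \<alpha> l =
     1 / ereal (Min ((\<lambda>k. Re (\<tau> (spectral_below_perp (- ((1 - \<alpha>) * l))
                                  (partial_sum x n - partial_sum x k)))) ` {1..n}))"

end

theory Submission
  imports Defs
begin

text \<open>
  The projection can be taken to be \<open>p = e\<^bsub>(\<lambda>, \<infinity>)\<^esub>(s\<^sub>k)\<close>, with \<open>k\<close> chosen to maximize \<open>\<tau>(p)\<close>. The lower
  bound is then trivial. For the upper bound, \<open>s\<^sub>k\<close> commutes with \<open>s\<^sub>n - s\<^sub>k\<close>, so the product of \<open>p\<close> and
  \<open>q = e\<^bsub>[-(1 - \<alpha>)\<lambda>, \<infinity>)\<^esub>(s\<^sub>n - s\<^sub>k)\<close> is a projection; comparing quadratic forms on its range shows that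
  it lies below \<open>e\<^bsub>(\<alpha>\<lambda>, \<infinity>)\<^esub>(s\<^sub>n)\<close>, and independence gives \<open>\<tau>(p q) = \<tau>(p) \<tau>(q)\<close>.

  What takes work is the spectral theorem for bounded self-adjoint operators, with its uniqueness
  part. It is proved for symmetric operators on real Hilbert spaces: the absolute value of
  \<open>x - t\<close> is a norm limit of polynomials; the projection \<open>e\<^sub>t\<close> onto the kernel of the positive part is
  a strong limit of polynomials; the functions \<open>t \<mapsto> \<langle>v, e\<^sub>t v\<rangle>\<close> define Stieltjes measures \<open>\<mu>\<^sub>v\<close>; and a
  Dynkin argument yields a projection with quadratic form \<open>v \<mapsto> \<mu>\<^sub>v(B)\<close> for every Borel set \<open>B\<close>.
\<close>

section \<open>Symmetric operators on a real Hilbert space\<close>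

text \<open>With \<open>m\<close> the minimum whose reciprocal is \<open>M_const\<close>, the upper
  bound is proved for every \<open>k\<close> in the division-free form
  \<open>f k * m \<le> Re (\<tau> R)\<close>, so that \<open>m = 0\<close> needs no separate
  treatment there. For \<open>k = n\<close> there is no later block of variables to be independent
  of; that case rests on \<open>m \<le> 1\<close> and \<open>\<alpha> * l \<le> l\<close>.

  Spectral projections are given by a definite description, so they become usable only once a
  resolution is known both to exist and to be unique. Since \<open>inner\<close> is the real part of
  \<open>cinner\<close> and operators are real-linear maps in the underlying type, the analysis can
  be done over the reals. What ties it back is one device: every constructed projection lies in each
  sequentially strongly closed algebra containing \<open>x\<close>. Applied to a commutant this
  gives commutation, applied to \<open>bounded_operators\<close> complex linearity, and applied to
  von Neumann algebras the membership that independence asks for. Integrals stay scalar throughout: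
  operators are compared through their quadratic forms.\<close>

lemma riesz_representation:
  fixes f :: "'a::{real_inner,complete_space} \<Rightarrow> real"
  assumes "bounded_linear f"
  shows "\<exists>w. \<forall>v. f v = inner w v"
proof -
  interpret f: bounded_linear f by fact
  \<comment> \<open>If \<open>w\<close> represents \<open>f\<close>, this is the squared distance
    from \<open>v\<close> to \<open>w\<close> minus the squared norm of \<open>w\<close>; so the
    representing vector is sought as a minimizer.\<close>
  define g where "g v = (norm v)\<^sup>2 - 2 * f v" for v
  define d where "d = Inf (range g)"
  have below: "- (onorm f)\<^sup>2 \<le> g v" for v
  proof -
    have "f v \<le> onorm f * norm v"
      using onorm[OF assms, of v] by simp
    moreover have "0 \<le> (norm v - onorm f)\<^sup>2"
      by simp
    ultimately show ?thesis
      unfolding g_def power2_diff by (simp add: mult.commute)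
  qed
  have bdd: "bdd_below (range g)"
    using below by (intro bdd_belowI2)
  have d_le: "d \<le> g v" for v
    unfolding d_def by (rule cINF_lower[OF bdd]) simp
  have "\<exists>v. g v < d + 1 / real (Suc n)" for n
    using cInf_lessD[of "range g" "d + 1 / real (Suc n)"] by (auto simp: d_def)
  then obtain V where V: "g (V n) < d + 1 / real (Suc n)" for n
    by metis
  have dist: "(norm (V m - V n))\<^sup>2 \<le> 2 / real (Suc m) + 2 / real (Suc n)" for m n
  proof -
    \<comment> \<open>Parallelogram law: the linear parts cancel, and the midpoint cannot do better
      than the infimum \<open>d\<close>.\<close>
    have "(norm (V m - V n))\<^sup>2 = 2 * g (V m) + 2 * g (V n) - 4 * g ((1 / 2) *\<^sub>R (V m + V n))"
      unfolding g_def
      by (simp add: f.scaleR f.add power2_norm_eq_inner inner_add_left inner_add_right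
          inner_diff_left inner_diff_right inner_commute algebra_simps)
    also have "\<dots> \<le> 2 / real (Suc m) + 2 / real (Suc n)"
      using V[of m] V[of n] d_le[of "(1 / 2) *\<^sub>R (V m + V n)"] by simp
    finally show ?thesis .
  qed
  have "Cauchy V"
  proof (rule CauchyI)
    fix e :: real
    assume "0 < e"
    then obtain N where N: "4 / e\<^sup>2 < real N"
      using reals_Archimedean2 by blast
    have "norm (V m - V n) < e" if "N \<le> m" "N \<le> n" for m n
    proof -
      have small: "2 / real (Suc k) < e\<^sup>2 / 2" if "N \<le> k" for k
      proof -
        have "4 / e\<^sup>2 < real (Suc k)"
          using N that by simp
        then show ?thesis
          using \<open>0 < e\<close> by (simp add: field_simps)
      qed
      have "(norm (V m - V n))\<^sup>2 < e\<^sup>2"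
        using dist[of m n] small[OF that(1)] small[OF that(2)] by simp
      then show ?thesis
        using \<open>0 < e\<close> power_less_imp_less_base by fastforce
    qed
    then show "\<exists>M. \<forall>m\<ge>M. \<forall>n\<ge>M. norm (V m - V n) < e"
      by blast
  qed
  then obtain w where w: "V \<longlonglongrightarrow> w"
    using Cauchy_convergent convergent_def by blast
  have "(\<lambda>n. g (V n)) \<longlonglongrightarrow> g w"
    unfolding g_def by (intro tendsto_intros w f.tendsto)
  moreover have "(\<lambda>n. d + 1 / real (Suc n)) \<longlonglongrightarrow> d"
    using tendsto_add[OF tendsto_const LIMSEQ_inverse_real_of_nat, of d]
    by (simp add: inverse_eq_divide)
  ultimately have "g w \<le> d"
    by (rule LIMSEQ_le) (use V less_imp_le in blast)
  then have min: "g w \<le> g v" for v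
    using d_le[of v] by simp
  have "f v = inner w v" for v
  proof (cases "v = 0")
    case False
    define c where "c = inner w v - f v"
    have "g (w + t *\<^sub>R v) = g w + 2 * t * c + t\<^sup>2 * (norm v)\<^sup>2" for t
      unfolding g_def c_def power2_norm_eq_inner f.add f.scaleR
      by (simp add: inner_add_left inner_add_right inner_commute power2_eq_square algebra_simps)
    then have "0 \<le> 2 * t * c + t\<^sup>2 * (norm v)\<^sup>2" for t
      using min[of "w + t *\<^sub>R v"] by simp
    \<comment> \<open>This \<open>t\<close> minimizes the quadratic polynomial in
      \<open>t\<close>.\<close>
    from this[of "- c / (norm v)\<^sup>2"] have "c\<^sup>2 / (norm v)\<^sup>2 \<le> 0"
      using False by (simp add: power2_eq_square field_simps)
    then show ?thesis
      using False by (simp add: c_def divide_le_0_iff)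
  qed (simp add: f.zero)
  then show ?thesis
    by blast
qed

lemma norm_le_imp_norm_blinfun_le:
  fixes a :: "'a::real_normed_vector \<Rightarrow>\<^sub>L 'b::real_normed_vector"
  assumes "\<And>v. norm (a v) \<le> norm v"
  shows "norm a \<le> 1"
  using assms by (intro norm_blinfun_bound) auto

lemma norm_blinfun_le_one:
  fixes a :: "'a::real_normed_vector \<Rightarrow>\<^sub>L 'b::real_normed_vector"
  assumes "norm a \<le> 1"
  shows "norm (a v) \<le> norm v"
  using norm_blinfun[of a v] mult_right_mono[OF assms norm_ge_zero[of v]] by simp

lemma contractive_strong_limit:
  fixes A :: "nat \<Rightarrow> 'a::real_normed_vector \<Rightarrow>\<^sub>L 'b::real_normed_vector"
  assumes bound: "\<And>n v. norm (A n v) \<le> norm v"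
    and conv: "\<And>v. convergent (\<lambda>n. A n v)"
  shows "\<exists>a :: 'a \<Rightarrow>\<^sub>L 'b. \<forall>v. (\<lambda>n. A n v) \<longlonglongrightarrow> a v"
proof -
  define f where "f v = lim (\<lambda>n. A n v)" for v
  have lim: "(\<lambda>n. A n v) \<longlonglongrightarrow> f v" for v
    using conv[of v] by (simp add: f_def convergent_LIMSEQ_iff)
  have "bounded_linear f"
  proof (rule bounded_linear_intro[where K = 1])
    show "f (u + v) = f u + f v" for u v
      using tendsto_add[OF lim[of u] lim[of v]]
      by (intro LIMSEQ_unique[OF lim]) (simp add: blinfun.add_right)
    show "f (r *\<^sub>R v) = r *\<^sub>R f v" for r v
      using tendsto_scaleR[OF tendsto_const lim[of v]]
      by (intro LIMSEQ_unique[OF lim]) (simp add: blinfun.scaleR_right)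
    show "norm (f v) \<le> norm v * 1" for v
      using LIMSEQ_le_const2[OF tendsto_norm[OF lim[of v]]] bound by auto
  qed
  then show ?thesis
    using lim by (metis bounded_linear_Blinfun_apply)
qed

section \<open>Symmetric operators and orthogonal projections on real spaces\<close>

definition symmetric_op :: "('a::real_inner \<Rightarrow>\<^sub>L 'a) \<Rightarrow> bool" where
  "symmetric_op a \<longleftrightarrow> (\<forall>u v. inner (a u) v = inner u (a v))"

definition orthogonal_projection :: "('a::real_inner \<Rightarrow>\<^sub>L 'a) \<Rightarrow> bool" where
  "orthogonal_projection p \<longleftrightarrow> symmetric_op p \<and> p o\<^sub>L p = p"

lemma symmetric_opD: "symmetric_op a \<Longrightarrow> inner (a u) v = inner u (a v)"
  by (simp add: symmetric_op_def)

lemma symmetric_op_algebra: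
  "symmetric_op 0"
  "symmetric_op id_blinfun"
  "symmetric_op a \<Longrightarrow> symmetric_op b \<Longrightarrow> symmetric_op (a + b)"
  "symmetric_op a \<Longrightarrow> symmetric_op b \<Longrightarrow> symmetric_op (a - b)"
  "symmetric_op a \<Longrightarrow> symmetric_op (r *\<^sub>R a)"
  "symmetric_op a \<Longrightarrow> symmetric_op (a o\<^sub>L a)"
  by (auto simp: symmetric_op_def blinfun.bilinear_simps inner_simps)

lemma symmetric_op_strong_limit:
  assumes "\<And>n. symmetric_op (A n)" "\<And>v. (\<lambda>n. blinfun_apply (A n) v) \<longlonglongrightarrow> blinfun_apply a v"
  shows "symmetric_op a"
  unfolding symmetric_op_def
proof (intro allI)
  fix u v
  have "(\<lambda>n. inner (A n u) v) \<longlonglongrightarrow> inner (a u) v"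
    by (intro tendsto_intros assms)
  moreover have "(\<lambda>n. inner (A n u) v) \<longlonglongrightarrow> inner u (a v)"
    by (subst symmetric_opD[OF assms(1)], intro tendsto_intros assms)
  ultimately show "inner (a u) v = inner u (a v)"
    by (rule LIMSEQ_unique)
qed

text \<open>Polarization: the form of the difference at \<open>u + v\<close> leaves twice the mixed
  term, by symmetry. Later identities between operators are reduced in this way to identities
  between scalar measures.\<close>

lemma symmetric_op_eqI:
  assumes a: "symmetric_op a" and b: "symmetric_op b"
    and form: "\<And>v. inner v (a v) = inner v (b v)"
  shows "a = b"
proof (rule blinfun_eqI)
  fix v
  define c where "c = a - b"
  have c: "symmetric_op c"
    using a b by (simp add: c_def symmetric_op_algebra)
  have zero: "inner v (c v) = 0" for v
    by (simp add: c_def form blinfun.bilinear_simps inner_simps)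
  have "inner u (c v) = 0" for u
    using zero[of "u + v"] zero[of u] zero[of v] symmetric_opD[OF c, of u v]
    by (simp add: blinfun.bilinear_simps inner_simps inner_commute)
  then have "c v = 0"
    using inner_eq_zero_iff by blast
  then show "a v = b v"
    by (simp add: c_def blinfun.bilinear_simps)
qed

lemma blinfun_compose_eqD:
  "a o\<^sub>L b = c o\<^sub>L d \<Longrightarrow> blinfun_apply a (blinfun_apply b v) = blinfun_apply c (blinfun_apply d v)"
  by (metis blinfun_apply_blinfun_compose)

lemma projection_symmetric:
  assumes "orthogonal_projection p"
  shows "inner (blinfun_apply p u) v = inner u (blinfun_apply p v)"
  using assms by (simp add: orthogonal_projection_def symmetric_op_def)

lemma projection_idem:
  assumes "orthogonal_projection p"
  shows "blinfun_apply p (blinfun_apply p v) = blinfun_apply p v"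
  using assms blinfun_apply_blinfun_compose[of p p v] by (simp add: orthogonal_projection_def)

lemma projection_form:
  assumes "orthogonal_projection p"
  shows "inner v (p v) = (norm (p v))\<^sup>2"
  by (simp add: power2_norm_eq_inner projection_symmetric[OF assms] projection_idem[OF assms])

lemma projection_norm_le:
  assumes "orthogonal_projection p"
  shows "norm (p v) \<le> norm v"
proof -
  have "norm (p v) * norm (p v) \<le> norm v * norm (p v)"
    using projection_form[OF assms, of v] norm_cauchy_schwarz[of v "p v"]
    by (simp add: power2_eq_square)
  then show ?thesis
    by (cases "p v = 0") simp_all
qed

lemma projection_complement:
  assumes "orthogonal_projection p"
  shows "orthogonal_projection (id_blinfun - p)"
proof -
  have "(id_blinfun - p) o\<^sub>L (id_blinfun - p) = id_blinfun - p"
    by (rule blinfun_eqI) (simp add: blinfun.bilinear_simps projection_idem[OF assms])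
  then show ?thesis
    using assms by (simp add: orthogonal_projection_def symmetric_op_algebra)
qed

lemma projection_pythagoras:
  assumes "orthogonal_projection p"
  shows "(norm v)\<^sup>2 = (norm (p v))\<^sup>2 + (norm (v - p v))\<^sup>2"
  using projection_form[OF assms, of v]
  by (simp add: power2_norm_eq_inner inner_simps inner_commute)

lemma projection_norm_eq_iff:
  assumes "orthogonal_projection p"
  shows "norm (p v) = norm v \<longleftrightarrow> p v = v"
  using projection_pythagoras[OF assms, of v] by auto

text \<open>Tested at \<open>p v\<close>, the inequality says that \<open>q\<close> does not shorten
  \<open>p v\<close>, and a projection fixes every vector that it does not shorten.\<close>

lemma projection_le_imp_absorb:
  assumes p: "orthogonal_projection p" and q: "orthogonal_projection q"
    and le: "\<And>v. inner v (p v) \<le> inner v (q v)"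
  shows "q (p v) = p v"
proof -
  have "(norm (p v))\<^sup>2 \<le> (norm (q (p v)))\<^sup>2"
    using le[of "p v"] projection_idem[OF p, of v]
    by (simp add: projection_form[OF q] power2_norm_eq_inner)
  then have "norm (q (p v)) = norm (p v)"
    using projection_norm_le[OF q, of "p v"] by simp
  then show ?thesis
    by (simp add: projection_norm_eq_iff[OF q])
qed

lemma projection_absorb_left:
  assumes p: "orthogonal_projection p" and q: "orthogonal_projection q"
    and absorb: "\<And>v. blinfun_apply q (blinfun_apply p v) = blinfun_apply p v"
  shows "blinfun_apply p (blinfun_apply q v) = blinfun_apply p v"
proof -
  have "inner u (p (q v)) = inner u (p v)" for u
    by (simp add: absorb flip: projection_symmetric[OF p] projection_symmetric[OF q])
  then show ?thesis
    using vector_eq_ldot by blast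
qed

lemma projection_diff:
  assumes p: "orthogonal_projection p" and q: "orthogonal_projection q"
    and absorb: "\<And>v. blinfun_apply q (blinfun_apply p v) = blinfun_apply p v"
  shows "orthogonal_projection (q - p)"
proof -
  have "(q - p) o\<^sub>L (q - p) = q - p"
    by (rule blinfun_eqI)
      (simp add: blinfun.bilinear_simps projection_idem[OF p] projection_idem[OF q] absorb
        projection_absorb_left[OF assms])
  then show ?thesis
    using p q by (simp add: orthogonal_projection_def symmetric_op_algebra)
qed

text \<open>The inequality says that \<open>p\<close> lies below the complement of \<open>q\<close>,
  which therefore absorbs \<open>p\<close>. For projections of disjoint Borel sets it will come from
  additivity of a measure of total mass \<open>inner v v\<close>.\<close>

lemma projection_orthogonal:
  assumes p: "orthogonal_projection p" and q: "orthogonal_projection q"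
    and le: "\<And>v. inner v (p v) + inner v (q v) \<le> inner v v"
  shows "q (p v) = 0"
proof -
  have "inner w (p w) \<le> inner w ((id_blinfun - q) w)" for w
    using le[of w] by (simp add: blinfun.diff_left inner_diff_right)
  from projection_le_imp_absorb[OF p projection_complement[OF q] this]
  show ?thesis
    by (simp add: blinfun.diff_left)
qed

lemma projection_sum:
  assumes p: "orthogonal_projection p" and q: "orthogonal_projection q"
    and le: "\<And>v. inner v (p v) + inner v (q v) \<le> inner v v"
  shows "orthogonal_projection (p + q)"
proof -
  have q_p: "q (p v) = 0" for v
    by (rule projection_orthogonal[OF p q le])
  have p_q: "p (q v) = 0" for v
    by (rule projection_orthogonal[OF q p]) (simp add: add.commute le)
  have "(p + q) o\<^sub>L (p + q) = p + q"
    by (rule blinfun_eqI)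
      (simp add: blinfun.bilinear_simps projection_idem[OF p] projection_idem[OF q] q_p p_q)
  then show ?thesis
    using p q by (simp add: orthogonal_projection_def symmetric_op_algebra)
qed

lemma projection_compose:
  assumes p: "orthogonal_projection p" and q: "orthogonal_projection q"
    and commute: "p o\<^sub>L q = q o\<^sub>L p"
  shows "orthogonal_projection (p o\<^sub>L q)"
proof -
  have c: "p (q v) = q (p v)" for v
    using blinfun_compose_eqD[OF commute] .
  have "inner (p (q u)) v = inner u (p (q v))" for u v
    by (simp add: c projection_symmetric[OF p] projection_symmetric[OF q])
  moreover have "(p o\<^sub>L q) o\<^sub>L (p o\<^sub>L q) = p o\<^sub>L q"
    by (rule blinfun_eqI) (simp add: c projection_idem[OF p] projection_idem[OF q])
  ultimately show ?thesis
    by (simp add: orthogonal_projection_def symmetric_op_def)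
qed

lemma projection_strong_limit:
  assumes proj: "\<And>n. orthogonal_projection (A n)"
    and lim: "\<And>v. (\<lambda>n. blinfun_apply (A n) v) \<longlonglongrightarrow> blinfun_apply a v"
  shows "orthogonal_projection a"
proof -
  have "a (a v) = a v" for v
  proof -
    \<comment> \<open>Both factors of \<open>A n (A n v)\<close> vary; the uniform bound on
      \<open>A n\<close> absorbs the error in the inner one.\<close>
    have "(\<lambda>n. A n (a v - A n v)) \<longlonglongrightarrow> 0"
    proof (rule Lim_null_comparison)
      show "\<forall>\<^sub>F n in sequentially. norm (A n (a v - A n v)) \<le> norm (a v - A n v)"
        using projection_norm_le[OF proj] by simp
      show "(\<lambda>n. norm (a v - A n v)) \<longlonglongrightarrow> 0"
        using tendsto_norm[OF tendsto_diff[OF tendsto_const lim[of v], of "a v"]] by simp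
    qed
    then have "(\<lambda>n. A n (a v) - A n v) \<longlonglongrightarrow> 0"
      by (simp add: blinfun.diff_right projection_idem[OF proj])
    moreover have "(\<lambda>n. A n (a v) - A n v) \<longlonglongrightarrow> a (a v) - a v"
      by (intro tendsto_intros lim)
    ultimately show ?thesis
      using LIMSEQ_unique by fastforce
  qed
  then have "a o\<^sub>L a = a"
    by (intro blinfun_eqI) simp
  then show ?thesis
    using symmetric_op_strong_limit[OF _ lim] proj by (simp add: orthogonal_projection_def)
qed

text \<open>Real scalars and limits of sequences match the constructions below: polynomials in
  \<open>x\<close> with real coefficients, followed by pointwise limits.\<close>

locale strong_algebra =
  fixes N :: "('a::real_normed_vector \<Rightarrow>\<^sub>L 'a) set"
  assumes one: "id_blinfun \<in> N"
    and add: "a \<in> N \<Longrightarrow> b \<in> N \<Longrightarrow> a + b \<in> N"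
    and scaleR: "a \<in> N \<Longrightarrow> r *\<^sub>R a \<in> N"
    and compose: "a \<in> N \<Longrightarrow> b \<in> N \<Longrightarrow> a o\<^sub>L b \<in> N"
    and strong_limit: "(\<And>n::nat. A n \<in> N) \<Longrightarrow>
      (\<And>v. (\<lambda>n. blinfun_apply (A n) v) \<longlonglongrightarrow> blinfun_apply a v) \<Longrightarrow> a \<in> N"
begin

lemma diff: "a \<in> N \<Longrightarrow> b \<in> N \<Longrightarrow> a - b \<in> N"
  using add[OF _ scaleR[of b "-1"]] by simp

lemma zero: "0 \<in> N"
  using diff[OF one one] by simp

end

text \<open>Turns "lies in every strong algebra containing \<open>x\<close>" into "commutes with
  everything that commutes with \<open>x\<close>".\<close>

lemma strong_algebra_commutant:
  fixes b :: "'a::real_normed_vector \<Rightarrow>\<^sub>L 'a"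
  shows "strong_algebra {a. a o\<^sub>L b = b o\<^sub>L a}"
proof -
  have mem: "a o\<^sub>L b = b o\<^sub>L a \<longleftrightarrow> (\<forall>v. blinfun_apply a (b v) = b (blinfun_apply a v))" for a
    by (metis blinfun_apply_blinfun_compose blinfun_eqI)
  have "a (b v) = b (a v)"
    if A: "\<And>n v. A n (b v) = b (A n v)" and lim: "\<And>v. (\<lambda>n. A n v) \<longlonglongrightarrow> a v"
    for A :: "nat \<Rightarrow> 'a \<Rightarrow>\<^sub>L 'a" and a :: "'a \<Rightarrow>\<^sub>L 'a" and v
  proof (rule LIMSEQ_unique[OF lim])
    show "(\<lambda>n. A n (b v)) \<longlonglongrightarrow> b (a v)"
      unfolding A by (intro tendsto_intros lim)
  qed
  then show ?thesis
    unfolding strong_algebra_def mem_Collect_eq mem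
    by (simp add: blinfun.bilinear_simps) blast
qed

section \<open>Spectral cuts\<close>

text \<open>
  The iteration \<open>y \<mapsto> (a + y\<^sup>2) / 2\<close> with \<open>a = 1 - z\<^sup>2\<close> has the fixed point \<open>1 - \<bar>z\<bar>\<close>. Its increments are
  dominated by those of the scalar iteration for \<open>a = 1\<close>, so it converges in norm.
\<close>

lemma symmetric_op_absolute_value:
  fixes z :: "'a::{real_inner,banach} \<Rightarrow>\<^sub>L 'a"
  assumes sym: "symmetric_op z" and le: "norm z \<le> 1"
  shows "\<exists>w. symmetric_op w \<and> w o\<^sub>L w = z o\<^sub>L z \<and> norm (id_blinfun - w) \<le> 1 \<and>
           (\<forall>N. strong_algebra N \<longrightarrow> z \<in> N \<longrightarrow> w \<in> N)"
proof -
  define a where "a = id_blinfun - (z o\<^sub>L z)"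
  define y where "y = rec_nat 0 (\<lambda>_ b. (1 / 2) *\<^sub>R (a + (b o\<^sub>L b)))"
  define t :: "nat \<Rightarrow> real" where "t = rec_nat 0 (\<lambda>_ r. (1 + r\<^sup>2) / 2)"
  have y_rec: "y 0 = 0" "y (Suc n) = (1 / 2) *\<^sub>R (a + (y n o\<^sub>L y n))" for n
    by (simp_all add: y_def)
  have t_rec: "t 0 = 0" "t (Suc n) = (1 + (t n)\<^sup>2) / 2" for n
    by (simp_all add: t_def)
  have norm_a: "norm a \<le> 1"
  proof (rule norm_le_imp_norm_blinfun_le)
    fix v
    have "(norm (a v))\<^sup>2 = (norm v)\<^sup>2 - 2 * inner v (z (z v)) + (norm (z (z v)))\<^sup>2"
      by (simp add: a_def blinfun.diff_left power2_norm_eq_inner inner_diff_left inner_diff_right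
          inner_commute)
    also have "inner v (z (z v)) = (norm (z v))\<^sup>2"
      by (simp add: power2_norm_eq_inner symmetric_opD[OF sym])
    also have "(norm (z (z v)))\<^sup>2 \<le> (norm (z v))\<^sup>2"
      by (intro power_mono norm_blinfun_le_one le) simp
    finally have "(norm (a v))\<^sup>2 \<le> (norm v)\<^sup>2"
      using zero_le_power2[of "norm (z v)"] by linarith
    then show "norm (a v) \<le> norm v"
      by (rule power2_le_imp_le) simp
  qed
  have t_bounds: "0 \<le> t n \<and> t n \<le> 1" for n
  proof (induction n)
    case (Suc n)
    then have "(t n)\<^sup>2 \<le> 1"
      by (simp add: power_le_one)
    then show ?case
      by (simp add: t_rec)
  qed (simp add: t_rec)
  have "t n \<le> t (Suc n)" for n
    using zero_le_power2[of "1 - t n"] unfolding t_rec power2_diff by simp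
  then have t_mono: "incseq t"
    by (rule incseq_SucI)
  have norm_y: "norm (y n) \<le> t n" for n
  proof (induction n)
    case (Suc n)
    have "norm (y n o\<^sub>L y n) \<le> (t n)\<^sup>2"
      using norm_blinfun_compose[of "y n" "y n"] mult_mono[OF Suc Suc] t_bounds[of n]
      by (simp add: power2_eq_square)
    then have "norm (a + (y n o\<^sub>L y n)) \<le> 1 + (t n)\<^sup>2"
      using norm_a norm_triangle_ineq[of a "y n o\<^sub>L y n"] by linarith
    then show ?case
      by (simp add: y_rec t_rec)
  qed (simp add: y_rec t_rec)
  have step: "norm (y (Suc n) - y n) \<le> t (Suc n) - t n" for n
  proof (induction n)
    case 0
    show ?case
      using norm_a by (simp add: y_rec t_rec)
  next
    case (Suc n)
    let ?d = "y (Suc n) - y n"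
    \<comment> \<open>The difference of two squares is written as
      \<open>b (b - c) + (b - c) c\<close>, valid without commutativity. The scalar iteration
      satisfies the same identity, which carries the domination over.\<close>
    have "y (Suc (Suc n)) - y (Suc n) = (1 / 2) *\<^sub>R ((y (Suc n) o\<^sub>L ?d) + (?d o\<^sub>L y n))"
      unfolding y_rec(2)[of "Suc n"] using y_rec(2)[of n]
      by (auto intro!: blinfun_eqI simp: blinfun.bilinear_simps algebra_simps)
    moreover have "norm (y (Suc n) o\<^sub>L ?d) \<le> t (Suc n) * (t (Suc n) - t n)"
      by (rule order_trans[OF norm_blinfun_compose])
        (intro mult_mono norm_y Suc norm_ge_zero, use t_bounds in simp)
    moreover have "norm (?d o\<^sub>L y n) \<le> (t (Suc n) - t n) * t n"
      by (rule order_trans[OF norm_blinfun_compose])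
        (intro mult_mono norm_y Suc norm_ge_zero, use order_trans[OF norm_ge_zero Suc] in simp)
    ultimately have "norm (y (Suc (Suc n)) - y (Suc n)) \<le>
        (t (Suc n) * (t (Suc n) - t n) + (t (Suc n) - t n) * t n) / 2"
      using norm_triangle_ineq[of "y (Suc n) o\<^sub>L ?d" "?d o\<^sub>L y n"] by simp
    also have "\<dots> = ((t (Suc n))\<^sup>2 - (t n)\<^sup>2) / 2"
      by (simp add: power2_eq_square algebra_simps)
    also have "\<dots> = (1 + (t (Suc n))\<^sup>2) / 2 - (1 + (t n)\<^sup>2) / 2"
      by (simp add: field_simps)
    also have "\<dots> = t (Suc (Suc n)) - t (Suc n)"
      by (simp only: t_rec)
    finally show ?case .
  qed
  have diff: "norm (y m - y n) \<le> t m - t n" if "n \<le> m" for m n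
    using that
  proof (induction m rule: dec_induct)
    case (step m)
    then show ?case
      using \<open>norm (y (Suc m) - y m) \<le> t (Suc m) - t m\<close>
        norm_triangle_ineq[of "y (Suc m) - y m" "y m - y n"] by simp
  qed simp
  have "convergent t"
    using t_mono t_bounds by (metis incseq_convergent convergentI)
  then have "Cauchy t"
    by (rule convergent_Cauchy)
  have "Cauchy y"
  proof (rule CauchyI')
    fix e :: real
    assume "0 < e"
    then obtain K where K: "\<bar>t m - t n\<bar> < e" if "K \<le> m" "K \<le> n" for m n
      using \<open>Cauchy t\<close> CauchyD[of t e] by (metis real_norm_def)
    have "dist (y m) (y n) < e" if "K \<le> m" "m < n" for m n
      using K[of n m] diff[of m n] that by (simp add: dist_norm norm_minus_commute)
    then show "\<exists>K. \<forall>m\<ge>K. \<forall>n>m. dist (y m) (y n) < e"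
      by blast
  qed
  then obtain l where l: "y \<longlonglongrightarrow> l"
    using Cauchy_convergent convergent_def by blast
  have l_apply: "(\<lambda>n. y n v) \<longlonglongrightarrow> l v" for v
    by (intro tendsto_intros l)
  have "(\<lambda>n. y (Suc n)) \<longlonglongrightarrow> (1 / 2) *\<^sub>R (a + (l o\<^sub>L l))"
    unfolding y_rec by (intro tendsto_intros l bounded_bilinear.tendsto[OF bounded_bilinear_blinfun_compose])
  then have fixpoint: "l = (1 / 2) *\<^sub>R (a + (l o\<^sub>L l))"
    using LIMSEQ_Suc[OF l] LIMSEQ_unique by blast
  have l_fix: "l (l v) = 2 *\<^sub>R l v - a v" for v
  proof -
    have "l v = (1 / 2) *\<^sub>R (a v + l (l v))"
      using arg_cong[OF fixpoint, of "\<lambda>b. blinfun_apply b v"]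
      by (simp add: blinfun.bilinear_simps)
    then have "2 *\<^sub>R l v = a v + l (l v)"
      by (metis scaleR_half_double scaleR_right_distrib scaleR_2)
    then show ?thesis
      by simp
  qed
  have "symmetric_op (y n)" for n
    by (induction n) (simp_all add: y_rec a_def sym symmetric_op_algebra)
  then have sym_l: "symmetric_op l"
    using l_apply by (rule symmetric_op_strong_limit)
  \<comment> \<open>This bound on \<open>id_blinfun - w\<close> stands in for positivity of
    \<open>w\<close>: it implies that the form of \<open>w\<close> is nonnegative.\<close>
  have norm_l: "norm l \<le> 1"
    using LIMSEQ_le_const2[OF tendsto_norm[OF l]] norm_y t_bounds order_trans by blast
  define w where "w = id_blinfun - l"
  have "w o\<^sub>L w = z o\<^sub>L z"
    by (rule blinfun_eqI)
      (simp add: w_def blinfun.bilinear_simps l_fix a_def scaleR_2)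
  moreover have "w \<in> N" if N: "strong_algebra N" "z \<in> N" for N
  proof -
    interpret strong_algebra N by fact
    have "y n \<in> N" for n
      by (induction n) (simp_all add: y_rec a_def zero one diff add compose scaleR N)
    then have "l \<in> N"
      using l_apply by (rule strong_limit)
    then show ?thesis
      by (simp add: w_def diff one)
  qed
  ultimately show ?thesis
    using sym_l norm_l by (intro exI[of _ w]) (simp add: w_def symmetric_op_algebra)
qed

text \<open>
  The projection is the strong limit of the powers of \<open>1 - h\<^sup>2\<close>, whose quadratic forms decrease.
\<close>

lemma kernel_projection_exists:
  fixes h :: "'a::{real_inner,banach} \<Rightarrow>\<^sub>L 'a"
  assumes sym: "symmetric_op h" and le: "norm h \<le> 1"
  shows "\<exists>p. orthogonal_projection p \<and> (\<forall>v. blinfun_apply p v = v \<longleftrightarrow> h v = 0) \<and>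
           (\<forall>N. strong_algebra N \<longrightarrow> h \<in> N \<longrightarrow> p \<in> N)"
proof -
  define g where "g = id_blinfun - (h o\<^sub>L h)"
  define G where "G = rec_nat id_blinfun (\<lambda>_ b. g o\<^sub>L b)"
  have G_rec: "G 0 v = v" "G (Suc n) v = g (G n v)" for n v
    by (simp_all add: G_def)
  have g: "g v = v - h (h v)" for v
    by (simp add: g_def blinfun.bilinear_simps)
  have sym_g: "inner (g u) v = inner u (g v)" for u v
    by (simp add: g inner_simps symmetric_opD[OF sym])
  have G_add: "inner (G m u) (G n v) = inner u (G (m + n) v)" for m n u v
  proof (induction m arbitrary: n)
    case (Suc m)
    show ?case
      using Suc[of "Suc n"] by (simp add: G_rec sym_g)
  qed (simp add: G_rec)
  have G_shift: "G n (g v) = g (G n v)" for n v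
    by (induction n) (simp_all add: G_rec)
  have G_h: "G n (h v) = h (G n v)" for n v
    by (induction n) (simp_all add: G_rec g blinfun.bilinear_simps)
  \<comment> \<open>The induction goes in steps of two, moving one factor \<open>g\<close> to each
    side; the bound on \<open>h\<close> enters at \<open>n = 1\<close>.\<close>
  have pos: "0 \<le> inner v (G n v)" for n v
  proof (induction n arbitrary: v rule: induct_nat_012)
    case 1
    have "(norm (h v))\<^sup>2 \<le> (norm v)\<^sup>2"
      by (intro power_mono norm_blinfun_le_one le) simp
    then show ?case
      by (simp add: G_rec g inner_simps power2_norm_eq_inner symmetric_opD[OF sym])
  next
    case (ge2 n)
    have "inner v (G (Suc (Suc n)) v) = inner (g v) (G n (g v))"
      by (simp add: G_rec G_shift sym_g)
    then show ?case
      using ge2(1)[of "g v"] by simp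
  qed (simp add: G_rec)
  have anti: "inner v (G (Suc n) v) \<le> inner v (G n v)" for n v
  proof -
    have "inner v (G n v) - inner v (G (Suc n) v) = inner (h v) (G n (h v))"
      by (simp add: G_rec g inner_simps G_h symmetric_opD[OF sym])
    then show ?thesis
      using pos[of "h v" n] by simp
  qed
  have "convergent (\<lambda>n. inner v (G n v))" for v
    by (rule decseq_convergent[OF decseq_SucI, of "\<lambda>n. inner v (G n v)" 0])
      (use anti pos in \<open>auto intro: convergentI\<close>)
  then have cauchy: "Cauchy (\<lambda>n. inner v (G n v))" for v
    by (rule convergent_Cauchy)
  have norm_G: "norm (G n v) \<le> norm v" for n v
  proof -
    have "decseq (\<lambda>n. inner v (G n v))"
      by (rule decseq_SucI) (rule anti)
    then have "inner v (G (n + n) v) \<le> inner v (G 0 v)"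
      by (rule decseqD) simp
    then have "(norm (G n v))\<^sup>2 \<le> (norm v)\<^sup>2"
      by (simp add: power2_norm_eq_inner G_add G_rec)
    then show ?thesis
      by (rule power2_le_imp_le) simp
  qed
  have "convergent (\<lambda>n. G n v)" for v
  proof (rule Cauchy_convergent, rule CauchyI)
    fix e :: real
    assume "0 < e"
    then have "0 < e\<^sup>2 / 2"
      by simp
    then obtain K where K: "\<bar>inner v (G m v) - inner v (G n v)\<bar> < e\<^sup>2 / 2"
      if "K \<le> m" "K \<le> n" for m n
      using CauchyD[OF cauchy[of v], of "e\<^sup>2 / 2"] by (metis real_norm_def)
    have "norm (G m v - G n v) < e" if "K \<le> m" "K \<le> n" for m n
    proof -
      \<comment> \<open>By \<open>G_add\<close> the square expands into values of the monotone
        scalar sequence, so its convergence yields strong convergence.\<close>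
      have "(norm (G m v - G n v))\<^sup>2 =
          (inner v (G (m + m) v) - inner v (G (m + n) v)) +
          (inner v (G (n + n) v) - inner v (G (m + n) v))"
        by (simp add: power2_norm_eq_inner inner_simps G_add add.commute)
      also have "\<dots> < e\<^sup>2"
        using abs_less_iff[THEN iffD1, OF K[of "m + m" "m + n"]]
          abs_less_iff[THEN iffD1, OF K[of "n + n" "m + n"]] that by linarith
      finally show ?thesis
        using \<open>0 < e\<close> power_less_imp_less_base by fastforce
    qed
    then show "\<exists>K. \<forall>m\<ge>K. \<forall>n\<ge>K. norm (G m v - G n v) < e"
      by blast
  qed
  then obtain p :: "'a \<Rightarrow>\<^sub>L 'a" where p: "(\<lambda>n. G n v) \<longlonglongrightarrow> p v" for v
    using contractive_strong_limit[of G] norm_G by blast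
  have fixed: "p v = v" if "h v = 0" for v
  proof -
    have "G n v = v" for n
      by (induction n) (simp_all add: G_rec g that blinfun.zero_right)
    then show ?thesis
      using p[of v] by (simp add: LIMSEQ_const_iff)
  qed
  have h_p: "h (p v) = 0" for v
  proof -
    \<comment> \<open>The limit is fixed by \<open>g\<close>, so \<open>h\<close> applied twice
      kills it; symmetry of \<open>h\<close> then makes the norm of \<open>h (p v)\<close>
      zero.\<close>
    have "(\<lambda>n. G (Suc n) v) \<longlonglongrightarrow> g (p v)"
      unfolding G_rec by (intro tendsto_intros p)
    then have "g (p v) = p v"
      using LIMSEQ_Suc[OF p[of v]] LIMSEQ_unique by blast
    then have "inner (p v) (h (h (p v))) = 0"
      by (simp add: g)
    then show ?thesis
      using symmetric_opD[OF sym, of "p v" "h (p v)"] by simp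
  qed
  have "p o\<^sub>L p = p"
    by (rule blinfun_eqI) (simp add: fixed h_p)
  moreover have "symmetric_op (G n)" for n
    using G_add[of 0] G_add[of n _ 0] by (simp add: symmetric_op_def G_rec)
  then have "symmetric_op p"
    using p by (rule symmetric_op_strong_limit)
  moreover have "p \<in> N" if N: "strong_algebra N" "h \<in> N" for N
  proof -
    interpret strong_algebra N by fact
    have "G n \<in> N" for n
      by (induction n) (simp_all add: G_def g_def one diff compose N)
    then show ?thesis
      using p by (rule strong_limit)
  qed
  ultimately show ?thesis
    using fixed h_p by (metis orthogonal_projection_def)
qed

text \<open>
  These properties single out the spectral projection of \<open>{..t}\<close> without reference to a resolution.
\<close>

definition spectral_cut :: "('a::real_inner \<Rightarrow>\<^sub>L 'a) \<Rightarrow> real \<Rightarrow> ('a \<Rightarrow>\<^sub>L 'a) \<Rightarrow> bool" where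
  "spectral_cut x t p \<longleftrightarrow>
     orthogonal_projection p \<and> p o\<^sub>L x = x o\<^sub>L p \<and>
     (\<forall>v. p v = v \<longrightarrow> inner v (x v) \<le> t * inner v v) \<and>
     (\<forall>v. p v = 0 \<longrightarrow> v \<noteq> 0 \<longrightarrow> t * inner v v < inner v (x v))"

text \<open>With \<open>z\<close> a positive multiple of \<open>x - t\<close> and \<open>w\<close>
  its absolute value, the cut is the projection onto the kernel of \<open>w + z\<close>. On its
  range \<open>z = - w\<close>, and on the orthogonal complement \<open>z = w\<close>.\<close>

lemma spectral_cut_exists:
  fixes x :: "'a::{real_inner,banach} \<Rightarrow>\<^sub>L 'a"
  assumes sym: "symmetric_op x"
  shows "\<exists>p. spectral_cut x t p \<and> (\<forall>N. strong_algebra N \<longrightarrow> x \<in> N \<longrightarrow> p \<in> N)"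
proof -
  \<comment> \<open>The summand 1 keeps the scaling defined and positive even when
    \<open>x = t *\<^sub>R id_blinfun\<close>.\<close>
  define c where "c = inverse (1 + norm (x - t *\<^sub>R id_blinfun))"
  define z where "z = c *\<^sub>R (x - t *\<^sub>R id_blinfun)"
  have c: "0 < c"
    by (simp add: c_def add_pos_nonneg)
  have "norm z \<le> 1"
    by (simp add: z_def c_def divide_simps add_pos_nonneg)
  moreover have sym_z: "symmetric_op z"
    by (simp add: z_def sym symmetric_op_algebra)
  ultimately obtain w where w: "symmetric_op w" "w o\<^sub>L w = z o\<^sub>L z" "norm (id_blinfun - w) \<le> 1"
    and w_mem: "\<And>N. strong_algebra N \<Longrightarrow> z \<in> N \<Longrightarrow> w \<in> N"
    using symmetric_op_absolute_value by blast
  \<comment> \<open>The factor one third compensates for norms at most 2 and 1 of \<open>w\<close>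
    and \<open>z\<close>.\<close>
  define h where "h = (1 / 3) *\<^sub>R (w + z)"
  have "norm w \<le> 2"
    using norm_triangle_ineq4[of id_blinfun "id_blinfun - w"] w(3) norm_blinfun_id_le[where 'a = 'a]
    by simp
  then have "norm h \<le> 1"
    using \<open>norm z \<le> 1\<close> norm_triangle_ineq[of w z] by (simp add: h_def)
  moreover have "symmetric_op h"
    by (simp add: h_def w sym_z symmetric_op_algebra)
  ultimately obtain p where p: "orthogonal_projection p" "\<And>v. blinfun_apply p v = v \<longleftrightarrow> h v = 0"
    and p_mem: "\<And>N. strong_algebra N \<Longrightarrow> h \<in> N \<Longrightarrow> p \<in> N"
    using kernel_projection_exists by blast
  have mem: "w \<in> N" "p \<in> N" if N: "strong_algebra N" "x \<in> N" for N
  proof -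
    interpret strong_algebra N by fact
    have "z \<in> N"
      by (simp add: z_def scaleR diff one N)
    then show "w \<in> N"
      by (rule w_mem[OF N(1)])
    then show "p \<in> N"
      using \<open>z \<in> N\<close> by (intro p_mem[OF N(1)]) (simp add: h_def scaleR add)
  qed
  have p_x: "p o\<^sub>L x = x o\<^sub>L p"
    using mem(2)[OF strong_algebra_commutant[of x]] by simp
  have "w o\<^sub>L x = x o\<^sub>L w"
    using mem(1)[OF strong_algebra_commutant[of x]] by simp
  then have w_x: "p o\<^sub>L w = w o\<^sub>L p" "x o\<^sub>L w = w o\<^sub>L x"
    using mem(2)[OF strong_algebra_commutant[of w]] by simp_all
  have z_apply: "z v = c *\<^sub>R (x v - t *\<^sub>R v)" for v
    by (simp add: z_def blinfun.bilinear_simps)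
  have form_z: "inner v (z v) = c * (inner v (x v) - t * inner v v)" for v
    by (simp add: z_apply inner_simps)
  have h_zero: "h v = 0 \<longleftrightarrow> w v + z v = 0" for v
    by (simp add: h_def blinfun.bilinear_simps)
  have norm_l: "norm (v - w v) \<le> norm v" for v
    using norm_blinfun_le_one[OF w(3), of v] by (simp add: blinfun.bilinear_simps)
  have form_w: "0 \<le> inner v (w v)" for v
  proof -
    have "inner v (v - w v) \<le> norm v * norm v"
      using norm_cauchy_schwarz[of v "v - w v"] mult_left_mono[OF norm_l[of v] norm_ge_zero[of v]]
      by simp
    then show ?thesis
      by (simp add: inner_diff_right flip: power2_norm_eq_inner power2_eq_square)
  qed
  have below: "inner v (x v) \<le> t * inner v v" if "p v = v" for v
  proof -
    have "w v + z v = 0"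
      using that by (simp add: p h_zero)
    then have "inner v (z v) = - inner v (w v)"
      by (metis add_eq_0_iff inner_minus_right)
    then have "inner v (z v) \<le> 0"
      using form_w[of v] by simp
    then show ?thesis
      using c by (simp add: form_z mult_le_0_iff)
  qed
  have above: "t * inner v v < inner v (x v)" if v: "p v = 0" "v \<noteq> 0" for v
  proof -
    \<comment> \<open>Since \<open>w\<close> and \<open>z\<close> commute and have equal squares,
      \<open>w + z\<close> kills \<open>u\<close>, so \<open>p\<close> fixes \<open>u\<close>. But
      \<open>p\<close> commutes with \<open>w\<close> and \<open>x\<close> and kills
      \<open>v\<close>, so it also kills \<open>u\<close>.\<close>
    define u where "u = w v - z v"
    have w_w: "w (w v) = z (z v)"
      by (rule blinfun_compose_eqD[OF w(2)])
    have w_z: "w (z v) = z (w v)"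
      by (simp add: z_apply blinfun.bilinear_simps blinfun_compose_eqD[OF w_x(2)])
    have "w u + z u = 0"
      by (simp add: u_def blinfun.diff_right w_w w_z)
    then have "p u = u"
      by (simp add: p h_zero)
    moreover have "p (w v) = 0" "p (x v) = 0"
      by (simp_all add: blinfun_compose_eqD[OF w_x(1)] blinfun_compose_eqD[OF p_x] v
          blinfun.zero_right)
    then have "p u = 0"
      by (simp add: u_def z_apply blinfun.bilinear_simps v)
    ultimately have w_eq: "w v = z v"
      by (simp add: u_def)
    have "inner v (z v) \<noteq> 0"
    proof
      assume zero: "inner v (z v) = 0"
      \<comment> \<open>If \<open>w v\<close> were orthogonal to \<open>v\<close>, Pythagoras and
        \<open>norm_l\<close> would leave no room for a nonzero \<open>w v\<close>. This is where
        strictness comes from.\<close>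
      have "(norm (v - w v))\<^sup>2 = (norm v)\<^sup>2 + (norm (w v))\<^sup>2"
        using zero by (simp add: w_eq power2_norm_eq_inner inner_simps inner_commute)
      moreover have "(norm (v - w v))\<^sup>2 \<le> (norm v)\<^sup>2"
        by (intro power_mono norm_l) simp
      ultimately have "w v = 0"
        by simp
      then have "h v = 0"
        by (simp add: h_zero flip: w_eq)
      then show False
        using v p(2)[of v] by simp
    qed
    then have "0 < inner v (z v)"
      using form_w[of v] by (simp add: w_eq)
    then show ?thesis
      using c by (simp add: form_z zero_less_mult_iff)
  qed
  show ?thesis
    using p(1) p_x below above mem(2) unfolding spectral_cut_def by blast
qed

text \<open>A vector in the range of \<open>p\<close> and the kernel of \<open>q\<close> would have
  a form at most \<open>s\<close> and above \<open>t\<close> times its squared norm. Commutation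
  ensures that the defect \<open>u\<close> is such a vector.\<close>

lemma spectral_cut_mono:
  assumes p: "spectral_cut x s p" and q: "spectral_cut x t q" and "s \<le> t"
    and commute: "p o\<^sub>L q = q o\<^sub>L p"
  shows "q (p v) = p v"
proof (rule ccontr)
  define u where "u = p v - q (p v)"
  assume "q (p v) \<noteq> p v"
  then have "u \<noteq> 0"
    by (simp add: u_def)
  have proj: "orthogonal_projection p" "orthogonal_projection q"
    using p q by (simp_all add: spectral_cut_def)
  have "p u = u" "q u = 0"
    by (simp_all add: u_def blinfun.diff_right blinfun_compose_eqD[OF commute]
        projection_idem[OF proj(1)] projection_idem[OF proj(2)])
  then have "t * inner u u < s * inner u u"
    using p q \<open>u \<noteq> 0\<close> unfolding spectral_cut_def by (meson less_le_trans)
  then show False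
    using \<open>s \<le> t\<close> \<open>u \<noteq> 0\<close> by simp
qed

text \<open>Two arbitrary cuts are known to commute only with \<open>x\<close>, not with each other.
  Each is therefore compared with the constructed cut \<open>e\<close>, which commutes with
  everything commuting with \<open>x\<close>.\<close>

lemma spectral_cut_unique:
  fixes x :: "'a::{real_inner,banach} \<Rightarrow>\<^sub>L 'a"
  assumes sym: "symmetric_op x" and p: "spectral_cut x t p" and q: "spectral_cut x t q"
  shows "p = q"
proof -
  obtain e where e: "spectral_cut x t e" "\<And>N. strong_algebra N \<Longrightarrow> x \<in> N \<Longrightarrow> e \<in> N"
    using spectral_cut_exists[OF sym] by blast
  have "a = e" if a: "spectral_cut x t a" for a
  proof -
    have "x o\<^sub>L a = a o\<^sub>L x"
      using a by (simp add: spectral_cut_def)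
    then have "e o\<^sub>L a = a o\<^sub>L e"
      using e(2)[OF strong_algebra_commutant[of a]] by simp
    then show ?thesis
      using spectral_cut_mono[OF a e(1) order_refl] spectral_cut_mono[OF e(1) a order_refl]
        blinfun_compose_eqD[of e a a e]
      by (intro blinfun_eqI) simp
  qed
  then show ?thesis
    using p q by blast
qed

lemma abs_form_le: "\<bar>inner v (blinfun_apply x v)\<bar> \<le> norm x * inner v v"
proof -
  have "\<bar>inner v (x v)\<bar> \<le> norm v * (norm x * norm v)"
    by (rule order_trans[OF Cauchy_Schwarz_ineq2]) (intro mult_left_mono norm_blinfun norm_ge_zero)
  then show ?thesis
    by (simp add: mult_ac power2_eq_square flip: power2_norm_eq_inner)
qed

lemma spectral_cut_below_norm:
  assumes p: "spectral_cut x t p" and "t < - norm x"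
  shows "p v = 0"
proof (rule ccontr)
  assume nz: "p v \<noteq> 0"
  have "p (p v) = p v"
    using p by (simp add: spectral_cut_def projection_idem)
  then have "inner (p v) (x (p v)) \<le> t * inner (p v) (p v)"
    using p by (simp add: spectral_cut_def)
  moreover have "t * inner (p v) (p v) < - norm x * inner (p v) (p v)"
    using assms(2) nz by (intro mult_strict_right_mono) auto
  ultimately show False
    using abs_form_le[of "p v" x] by simp
qed

lemma spectral_cut_above_norm:
  assumes p: "spectral_cut x t p" and "norm x \<le> t"
  shows "p v = v"
proof (rule ccontr)
  define u where "u = v - p v"
  assume "p v \<noteq> v"
  then have "u \<noteq> 0"
    by (simp add: u_def)
  moreover have "p u = 0"
    using p by (simp add: u_def spectral_cut_def projection_idem blinfun.diff_right)
  ultimately have "t * inner u u < inner u (x u)"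
    using p by (simp add: spectral_cut_def)
  moreover have "norm x * inner u u \<le> t * inner u u"
    using assms(2) by (intro mult_right_mono) auto
  ultimately show False
    using abs_form_le[of u x] by simp
qed

section \<open>Projections of Borel sets\<close>

text \<open>Made for monotone sequences of projections applied to a vector: by the Pythagorean
  identity \<open>projection_norm_diff\<close> the hypothesis holds for their forms, so monotone
  scalar convergence becomes norm convergence.\<close>

lemma convergent_if_norm_diff_le:
  fixes X :: "nat \<Rightarrow> 'a::banach"
  assumes le: "\<And>m n. m \<le> n \<Longrightarrow> (norm (X n - X m))\<^sup>2 \<le> \<bar>f n - f m\<bar>" and "convergent f"
  shows "convergent X"
proof (rule Cauchy_convergent, rule CauchyI')
  fix e :: real
  assume "0 < e"
  then obtain K where K: "\<bar>f m - f n\<bar> < e\<^sup>2" if "K \<le> m" "K \<le> n" for m n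
    using CauchyD[OF convergent_Cauchy[OF \<open>convergent f\<close>], of "e\<^sup>2"] by (auto simp: real_norm_def)
  have "dist (X m) (X n) < e" if "K \<le> m" "m < n" for m n
  proof -
    have "(norm (X n - X m))\<^sup>2 < e\<^sup>2"
      using le[of m n] K[of n m] that by simp
    then have "norm (X n - X m) < e"
      using \<open>0 < e\<close> power_less_imp_less_base by fastforce
    then show ?thesis
      by (simp add: dist_norm norm_minus_commute)
  qed
  then show "\<exists>K. \<forall>m\<ge>K. \<forall>n>m. dist (X m) (X n) < e"
    by blast
qed

lemma projection_norm_diff:
  assumes p: "orthogonal_projection p" and q: "orthogonal_projection q"
    and absorb: "\<And>v. blinfun_apply q (blinfun_apply p v) = blinfun_apply p v"
  shows "(norm (q v - p v))\<^sup>2 = inner v (q v) - inner v (p v)"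
  using projection_form[OF projection_diff[OF assms], of v]
  by (simp add: blinfun.diff_left inner_diff_right)

text \<open>Multiplicativity on intersections is deliberately kept out of the Dynkin induction. The
  induction carries just the form, the projection property and membership; the product rule is
  recovered from the forms afterwards.\<close>

lemma borel_projections_exist:
  fixes x :: "'a::{real_inner,banach} \<Rightarrow>\<^sub>L 'a"
  assumes sym: "symmetric_op x"
  shows "\<exists>E \<mu>. (\<forall>v. finite_measure (\<mu> v) \<and> sets (\<mu> v) = sets borel \<and> measure (\<mu> v) UNIV = inner v v) \<and>
    (\<forall>B \<in> sets borel. orthogonal_projection (E B) \<and>
      (\<forall>v. inner v (blinfun_apply (E B) v) = measure (\<mu> v) B) \<and>
      (\<forall>N. strong_algebra N \<longrightarrow> x \<in> N \<longrightarrow> E B \<in> N)) \<and>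
    (\<forall>t. spectral_cut x t (E {..t}))"
proof -
  obtain e where cut: "\<And>t. spectral_cut x t (e t)"
    and e_mem: "\<And>N t. strong_algebra N \<Longrightarrow> x \<in> N \<Longrightarrow> e t \<in> N"
    using spectral_cut_exists[OF sym] by metis
  have proj: "orthogonal_projection (e t)" and e_x: "x o\<^sub>L e t = e t o\<^sub>L x" for t
    using cut[of t] by (simp_all add: spectral_cut_def)
  have below: "inner v (x v) \<le> t * inner v v" if "e t v = v" for t v
    using cut[of t] that by (simp add: spectral_cut_def)
  have above: "t * inner v v < inner v (x v)" if "e t v = 0" "v \<noteq> 0" for t v
    using cut[of t] that by (simp add: spectral_cut_def)
  have commute: "e s o\<^sub>L e t = e t o\<^sub>L e s" for s t
    using e_mem[OF strong_algebra_commutant[of "e t"]] e_x by simp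
  have absorb: "e t (e s v) = e s v" if "s \<le> t" for s t v
    using that by (rule spectral_cut_mono[OF cut cut _ commute])
  have absorb': "e s (e t v) = e s v" if "s \<le> t" for s t v
    using absorb[OF that] blinfun_compose_eqD[OF commute] by metis
  define F where "F v t = inner v (e t v)" for v t
  have F_mono: "F v s \<le> F v t" if "s \<le> t" for v s t
  proof -
    have "0 \<le> inner v (e t v) - inner v (e s v)"
      using projection_norm_diff[OF proj proj absorb[OF that]] by (metis zero_le_power2)
    then show ?thesis
      by (simp add: F_def)
  qed
  have F_bot: "F v t = 0" if "t < - norm x" for v t
    by (simp add: F_def spectral_cut_below_norm[OF cut that])
  have F_top: "F v t = inner v v" if "norm x \<le> t" for v t
    by (simp add: F_def spectral_cut_above_norm[OF cut that])
  have F_right: "continuous (at_right a) (F v)" for v a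
  proof -
    define s where "s n = a + 1 / real (Suc n)" for n
    have s_gt: "a < s n" for n
      by (simp add: s_def)
    have s_anti: "s n \<le> s m" if "m \<le> n" for m n
      using that by (simp add: s_def frac_le)
    have s_lim: "s \<longlonglongrightarrow> a"
      using tendsto_add[OF tendsto_const LIMSEQ_inverse_real_of_nat, of a]
      by (simp add: s_def[abs_def] inverse_eq_divide)
    have "decseq (\<lambda>n. F v (s n))"
      by (auto simp: decseq_def intro: F_mono s_anti)
    then have "convergent (\<lambda>n. F v (s n))"
      using F_mono[OF less_imp_le[OF s_gt]] by (metis convergentI decseq_convergent)
    then have "convergent (\<lambda>n. e (s n) v)"
    proof (rule convergent_if_norm_diff_le[rotated])
      fix m n :: nat
      assume "m \<le> n"
      then show "(norm (e (s n) v - e (s m) v))\<^sup>2 \<le> \<bar>F v (s n) - F v (s m)\<bar>"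
        using projection_norm_diff[OF proj proj absorb[OF s_anti], of m n v]
        by (simp add: F_def norm_minus_commute)
    qed
    then obtain w where w: "(\<lambda>n. e (s n) v) \<longlonglongrightarrow> w"
      by (auto simp: convergent_def)
    \<comment> \<open>The candidate jump at \<open>a\<close>: it is fixed by every
      \<open>e (s n)\<close>, so its form is at most \<open>a\<close> times its squared norm, but it
      is killed by \<open>e a\<close>, where the form is strictly larger unless
      \<open>u = 0\<close>.\<close>
    define u where "u = w - e a v"
    have "e (s n) w = w" for n
    proof (rule LIMSEQ_unique)
      show "(\<lambda>k. e (s n) (e (s k) v)) \<longlonglongrightarrow> e (s n) w"
        by (intro tendsto_intros w)
      have "\<forall>\<^sub>F k in sequentially. e (s k) v = e (s n) (e (s k) v)"
        using eventually_ge_at_top[of n] by eventually_elim (simp add: absorb s_anti)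
      then show "(\<lambda>k. e (s n) (e (s k) v)) \<longlonglongrightarrow> w"
        by (rule Lim_transform_eventually[OF w])
    qed
    then have "e (s n) u = u" for n
      using s_gt[of n] by (simp add: u_def blinfun.diff_right absorb)
    then have "inner u (x u) \<le> s n * inner u u" for n
      by (rule below)
    then have le: "inner u (x u) \<le> a * inner u u"
      by (intro LIMSEQ_le_const[OF tendsto_mult_right[OF s_lim]]) blast
    have "e a w = e a v"
    proof (rule LIMSEQ_unique)
      show "(\<lambda>k. e a (e (s k) v)) \<longlonglongrightarrow> e a w"
        by (intro tendsto_intros w)
      show "(\<lambda>k. e a (e (s k) v)) \<longlonglongrightarrow> e a v"
        using s_gt by (simp add: absorb' less_imp_le)
    qed
    then have "e a u = 0"
      by (simp add: u_def blinfun.diff_right projection_idem[OF proj])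
    then have "u = 0"
      using above[of a u] le by fastforce
    then have "(\<lambda>n. F v (s n)) \<longlonglongrightarrow> F v a"
      unfolding F_def using w by (intro tendsto_inner[OF tendsto_const]) (simp add: u_def)
    have "\<exists>d>0. F v (a + d) - F v a < r" if "0 < r" for r
    proof -
      have "\<forall>\<^sub>F n in sequentially. F v (s n) < F v a + r"
        by (rule order_tendstoD(2)[OF \<open>(\<lambda>n. F v (s n)) \<longlonglongrightarrow> F v a\<close>]) (use that in simp)
      then obtain n where "F v (s n) < F v a + r"
        by (auto simp: eventually_sequentially)
      then show ?thesis
        by (intro exI[of _ "1 / real (Suc n)"]) (simp add: s_def)
    qed
    then show ?thesis
      using continuous_at_right_real_increasing[of "F v" a] F_mono by blast
  qed
  define \<mu> where "\<mu> v = interval_measure (F v)" for v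
  have sets_\<mu>: "sets (\<mu> v) = sets borel" and space_\<mu>: "space (\<mu> v) = UNIV" for v
    by (simp_all add: \<mu>_def)
  have \<mu>_atMost: "emeasure (\<mu> v) {..t} = ennreal (F v t)" for v t
  proof (rule LIMSEQ_unique)
    have "(\<Union>n. {- real n<..t}) = {..t}"
      by (auto simp: minus_less_iff reals_Archimedean2)
    moreover have "incseq (\<lambda>n. {- real n<..t})"
      by (rule incseq_SucI) auto
    moreover have "range (\<lambda>n. {- real n<..t}) \<subseteq> sets (\<mu> v)"
      by (auto simp: sets_\<mu>)
    ultimately show "(\<lambda>n. emeasure (\<mu> v) {- real n<..t}) \<longlonglongrightarrow> emeasure (\<mu> v) {..t}"
      using Lim_emeasure_incseq by metis
    \<comment> \<open>From \<open>K\<close> on, \<open>- real n\<close> lies below the spectrum, so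
      \<open>F v\<close> vanishes there, and also below \<open>t\<close>, so the half-open interval
      formula applies.\<close>
    obtain K where K: "max (norm x) (- t) < real K"
      using reals_Archimedean2 by blast
    have "\<forall>\<^sub>F n in sequentially. ennreal (F v t) = emeasure (\<mu> v) {- real n<..t}"
      using eventually_ge_at_top[of K]
    proof eventually_elim
      case (elim n)
      then have "real K \<le> real n"
        by simp
      then have "norm x < real n" "- real n \<le> t"
        using K by auto
      then show ?case
        unfolding \<mu>_def
        by (subst emeasure_interval_measure_Ioc) (auto simp: F_mono F_right F_bot)
    qed
    then show "(\<lambda>n. emeasure (\<mu> v) {- real n<..t}) \<longlonglongrightarrow> ennreal (F v t)"
      by (rule Lim_transform_eventually[OF tendsto_const])
  qed
  have \<mu>_UNIV: "emeasure (\<mu> v) UNIV = ennreal (inner v v)" for v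
  proof (rule LIMSEQ_unique)
    have "(\<Union>n. {..real n}) = UNIV"
      by (auto simp: real_arch_simple)
    moreover have "incseq (\<lambda>n. {..real n})"
      by (rule incseq_SucI) auto
    moreover have "range (\<lambda>n. {..real n}) \<subseteq> sets (\<mu> v)"
      by (auto simp: sets_\<mu>)
    ultimately show "(\<lambda>n. emeasure (\<mu> v) {..real n}) \<longlonglongrightarrow> emeasure (\<mu> v) UNIV"
      using Lim_emeasure_incseq by metis
    obtain K where K: "norm x \<le> real K"
      using real_arch_simple by blast
    have "\<forall>\<^sub>F n in sequentially. ennreal (inner v v) = emeasure (\<mu> v) {..real n}"
      using eventually_ge_at_top[of K]
      by eventually_elim (use K in \<open>simp add: \<mu>_atMost F_top\<close>)
    then show "(\<lambda>n. emeasure (\<mu> v) {..real n}) \<longlonglongrightarrow> ennreal (inner v v)"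
      by (rule Lim_transform_eventually[OF tendsto_const])
  qed
  have fin: "finite_measure (\<mu> v)" for v
    by (rule finite_measureI) (simp add: space_\<mu> \<mu>_UNIV)
  have measure_UNIV: "measure (\<mu> v) UNIV = inner v v" for v
    by (simp add: measure_def \<mu>_UNIV)
  have measure_atMost: "measure (\<mu> v) {..t} = inner v (e t v)" for v t
    using projection_form[OF proj] by (simp add: measure_def \<mu>_atMost F_def)
  define good where "good B p \<longleftrightarrow> orthogonal_projection p \<and>
      (\<forall>v. inner v (blinfun_apply p v) = measure (\<mu> v) B) \<and>
      (\<forall>N. strong_algebra N \<longrightarrow> x \<in> N \<longrightarrow> p \<in> N)" for B p
  have "\<exists>p. good B p" if "B \<in> sets borel" for B
  proof -
    have borel: "sets borel = sigma_sets UNIV (range (\<lambda>t::real. {..t}))"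
      by (subst borel_eq_atMost) simp
    have Int_stable: "Int_stable (range (\<lambda>t::real. {..t}))"
      by (auto simp: Int_stable_def)
    have sub: "range (\<lambda>t::real. {..t}) \<subseteq> Pow UNIV"
      by simp
    have "B \<in> sigma_sets UNIV (range (\<lambda>t::real. {..t}))"
      using that by (simp add: borel)
    from Int_stable sub this show ?thesis
    proof (induction B rule: sigma_sets_induct_disjoint)
      case (basic A)
      then obtain t where "A = {..t}"
        by blast
      then have "good A (e t)"
        by (simp add: good_def proj measure_atMost e_mem)
      then show ?case
        by blast
    next
      case empty
      have "good {} 0"
        by (auto simp: good_def orthogonal_projection_def symmetric_op_algebra intro: strong_algebra.zero)
      then show ?case
        by blast
    next
      case (compl A)
      then obtain p where p: "good A p"
        by blast
      have "inner v ((id_blinfun - p) v) = measure (\<mu> v) (UNIV - A)" for v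
        using compl(1) p finite_measure.finite_measure_compl[OF fin, of A v]
        by (simp add: good_def blinfun.diff_left inner_diff_right measure_UNIV space_\<mu> sets_\<mu> borel)
      then have "good (UNIV - A) (id_blinfun - p)"
        using p by (simp add: good_def projection_complement strong_algebra.diff strong_algebra.one)
      then show ?case
        by blast
    next
      case (union A)
      then obtain p where p: "\<And>i. good (A i) (p i)"
        by metis
      define q where "q n = (\<Sum>i<n. p i)" for n
      have sums: "(\<lambda>i. measure (\<mu> v) (A i)) sums measure (\<mu> v) (\<Union>i. A i)" for v
        using union(1,2) finite_measure.finite_measure_UNION[OF fin, of A v]
        by (auto simp: sets_\<mu> borel)
      have form_q: "inner v (q n v) = (\<Sum>i<n. measure (\<mu> v) (A i))" for n v
        using p by (simp add: q_def blinfun.sum_left inner_sum_right good_def)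
      have sum_le: "(\<Sum>i<n. measure (\<mu> v) (A i)) \<le> inner v v" for n v
      proof -
        have "(\<Sum>i<n. measure (\<mu> v) (A i)) \<le> measure (\<mu> v) (\<Union>i. A i)"
          using sum_le_suminf[OF sums_summable[OF sums[of v]], of "{..<n}"] sums_unique[OF sums[of v]]
          by simp
        also have "\<dots> \<le> inner v v"
          using finite_measure.bounded_measure[OF fin, of v "\<Union>i. A i"]
          by (simp add: space_\<mu> measure_UNIV)
        finally show ?thesis .
      qed
      have proj_q: "orthogonal_projection (q n)" for n
      proof (induction n)
        case 0
        show ?case
          by (simp add: q_def orthogonal_projection_def symmetric_op_algebra)
      next
        case (Suc n)
        \<comment> \<open>Disjointness of the sets enters only through the measure: the forms add up
          to at most \<open>inner v v\<close>, and this already makes the ranges orthogonal.\<close>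
        have "orthogonal_projection (q n + p n)"
        proof (rule projection_sum[OF Suc])
          show "orthogonal_projection (p n)"
            using p[of n] by (simp add: good_def)
          show "inner v (q n v) + inner v (p n v) \<le> inner v v" for v
            using sum_le[where n = "Suc n" and v = v] p[of n] by (simp add: form_q good_def)
        qed
        then show ?case
          by (simp add: q_def add.commute)
      qed
      have q_le: "inner v (q m v) \<le> inner v (q n v)" if "m \<le> n" for m n v
        unfolding form_q using that by (intro sum_mono2) auto
      have absorb_q: "q n (q m v) = q m v" if "m \<le> n" for m n v
        by (rule projection_le_imp_absorb[OF proj_q proj_q q_le[OF that]])
      have conv_form: "(\<lambda>n. inner v (q n v)) \<longlonglongrightarrow> measure (\<mu> v) (\<Union>i. A i)" for v
        using sums[of v] by (simp add: form_q sums_def)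
      have "convergent (\<lambda>n. q n v)" for v
      proof (rule convergent_if_norm_diff_le)
        show "convergent (\<lambda>n. inner v (q n v))"
          using conv_form by (rule convergentI)
        show "(norm (q n v - q m v))\<^sup>2 \<le> \<bar>inner v (q n v) - inner v (q m v)\<bar>" if "m \<le> n" for m n
          using projection_norm_diff[OF proj_q proj_q absorb_q[OF that]] by simp
      qed
      then obtain r :: "'a \<Rightarrow>\<^sub>L 'a" where r: "(\<lambda>n. q n v) \<longlonglongrightarrow> r v" for v
        using contractive_strong_limit[of q] projection_norm_le[OF proj_q] by blast
      have "orthogonal_projection r"
        using proj_q r by (rule projection_strong_limit)
      moreover have "inner v (r v) = measure (\<mu> v) (\<Union>i. A i)" for v
        by (rule LIMSEQ_unique[OF _ conv_form]) (intro tendsto_intros r)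
      moreover have "r \<in> N" if N: "strong_algebra N" "x \<in> N" for N
      proof -
        interpret strong_algebra N by fact
        have "p i \<in> N" for i
          using p[of i] N by (simp add: good_def)
        then have "q n \<in> N" for n
          by (induction n) (simp_all add: q_def zero add)
        then show ?thesis
          using r by (rule strong_limit)
      qed
      ultimately have "good (\<Union>i. A i) r"
        by (simp add: good_def)
      then show ?case
        by blast
    qed
  qed
  then obtain E where E: "\<And>B. B \<in> sets borel \<Longrightarrow> good B (E B)"
    by metis
  \<comment> \<open>\<open>E\<close> was obtained by choice, but its form determines it.\<close>
  have "E {..t} = e t" for t
    using E[of "{..t}"] proj[of t]
    by (intro symmetric_op_eqI) (simp_all add: good_def orthogonal_projection_def measure_atMost)
  then show ?thesis
    using E cut fin sets_\<mu> measure_UNIV unfolding good_def by (intro exI[of _ E] exI[of _ \<mu>]) simp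
qed

section \<open>The spectral theorem\<close>

instance complex_hilbert_space \<subseteq> banach ..

section \<open>Passage between the real and the complex inner product; adjoints\<close>

lemma Im_cinner: "Im (cinner u v) = inner u ((- \<i>) *\<^sub>C v)"
  using Re_cinner[of u "(- \<i>) *\<^sub>C v"] by (simp add: cinner_scaleC_right)

text \<open>The imaginary part is the real part at a rotated vector, and complex linearity of
  \<open>a\<close> moves the rotation out.\<close>

lemma cinner_eqI:
  assumes a: "a \<in> bounded_operators"
    and real: "\<And>v. inner u' v = inner u (blinfun_apply a v)"
  shows "cinner u' v = cinner u (a v)"
proof (rule complex_eqI)
  show "Re (cinner u' v) = Re (cinner u (a v))"
    by (simp add: Re_cinner real)
  have "(- \<i>) *\<^sub>C a v = a ((- \<i>) *\<^sub>C v)"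
    using a by (simp add: bounded_operators_def)
  then show "Im (cinner u' v) = Im (cinner u (a v))"
    by (simp only: Im_cinner real)
qed

lemma cadjoint_eqI:
  assumes "\<And>u v. cinner (blinfun_apply b u) v = cinner u (blinfun_apply a v)"
  shows "cadjoint a = b"
  unfolding cadjoint_def
proof (rule the_equality)
  fix c
  assume "\<forall>u v. cinner (blinfun_apply c u) v = cinner u (blinfun_apply a v)"
  then have "inner (c u) v = inner (b u) v" for u v
    using assms by (metis Re_cinner)
  then show "c = b"
    by (intro blinfun_eqI) (use vector_eq_rdot in blast)
qed (use assms in blast)

lemma real_adjoint_exists:
  fixes a :: "'a::{real_inner,complete_space} \<Rightarrow>\<^sub>L 'a"
  shows "\<exists>b :: 'a \<Rightarrow>\<^sub>L 'a. \<forall>u v. inner (b u) v = inner u (a v)"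
proof -
  have "\<exists>w. \<forall>v. inner u (a v) = inner w v" for u
    by (intro riesz_representation bounded_linear_inner_right_comp blinfun.bounded_linear_right)
  then obtain f where f: "\<And>u v. inner u (a v) = inner (f u) v"
    by metis
  have "bounded_linear f"
  proof (rule bounded_linear_intro[where K = "norm a"])
    have eq: "u = w" if "\<And>v. inner u v = inner w v" for u w :: 'a
      using that vector_eq_rdot by blast
    show "f (u + w) = f u + f w" for u w
      by (rule eq) (simp add: inner_add_left flip: f)
    show "f (r *\<^sub>R u) = r *\<^sub>R f u" for r u
      by (rule eq) (simp flip: f)
    show "norm (f u) \<le> norm u * norm a" for u
    proof (cases "f u = 0")
      case False
      have "(norm (f u))\<^sup>2 = inner u (a (f u))"
        by (simp add: power2_norm_eq_inner f)
      also have "\<dots> \<le> norm u * norm (a (f u))"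
        by (rule norm_cauchy_schwarz)
      also have "\<dots> \<le> norm u * (norm a * norm (f u))"
        by (intro mult_left_mono norm_blinfun norm_ge_zero)
      finally show ?thesis
        using False by (simp add: power2_eq_square flip: mult.assoc)
    qed simp
  qed
  then show ?thesis
    using f by (metis bounded_linear_Blinfun_apply)
qed

text \<open>From left to right, \<open>cadjoint a = a\<close> carries information only once an
  adjoint is known to exist, since \<open>cadjoint\<close> is a definite description; existence
  comes from the Riesz representation.\<close>

lemma selfadjoint_iff: "selfadjoint a \<longleftrightarrow> a \<in> bounded_operators \<and> symmetric_op a"
proof
  assume a: "selfadjoint a"
  then have bdd: "a \<in> bounded_operators"
    by (simp add: selfadjoint_def)
  obtain b where b: "\<And>u v. inner (blinfun_apply b u) v = inner u (blinfun_apply a v)"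
    using real_adjoint_exists by blast
  then have "cadjoint a = b"
    by (intro cadjoint_eqI cinner_eqI bdd)
  then show "a \<in> bounded_operators \<and> symmetric_op a"
    using a b by (simp add: selfadjoint_def symmetric_op_def)
next
  assume "a \<in> bounded_operators \<and> symmetric_op a"
  then show "selfadjoint a"
    unfolding selfadjoint_def symmetric_op_def by (auto intro!: cadjoint_eqI cinner_eqI)
qed

lemma projection_iff: "projection p \<longleftrightarrow> p \<in> bounded_operators \<and> orthogonal_projection p"
  by (auto simp: projection_def orthogonal_projection_def selfadjoint_iff)

lemma cinner_selfadjoint:
  assumes "selfadjoint a"
  shows "cinner v (a v) = complex_of_real (inner v (a v))"
proof -
  have "cinner (a v) v = cinner v (a v)"
    using assms by (intro cinner_eqI) (auto simp: selfadjoint_iff symmetric_op_def)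
  then have "cnj (cinner v (a v)) = cinner v (a v)"
    by (simp flip: cinner_commute)
  then show ?thesis
    by (simp add: complex_eq_iff Re_cinner)
qed

lemma strong_algebra_bounded_operators:
  "strong_algebra (bounded_operators :: 'h::complex_hilbert_space oper set)"
proof
  fix A :: "nat \<Rightarrow> 'h oper" and a :: "'h oper"
  assume A: "\<And>n. A n \<in> bounded_operators" and lim: "\<And>v. (\<lambda>n. A n v) \<longlonglongrightarrow> a v"
  have "a (c *\<^sub>C v) = c *\<^sub>C a v" for c v
  proof (rule LIMSEQ_unique[OF lim])
    have "(\<lambda>n. c *\<^sub>C A n v) \<longlonglongrightarrow> c *\<^sub>C a v"
      by (intro bounded_linear.tendsto[OF bounded_linear_scaleC[OF bounded_linear_ident]] lim)
    then show "(\<lambda>n. A n (c *\<^sub>C v)) \<longlonglongrightarrow> c *\<^sub>C a v"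
      using A by (simp add: bounded_operators_def)
  qed
  then show "a \<in> bounded_operators"
    by (simp add: bounded_operators_def)
next
  fix a :: "'h oper" and r :: real
  assume "a \<in> bounded_operators"
  then have "r *\<^sub>R a (c *\<^sub>C v) = c *\<^sub>C r *\<^sub>R a v" for c v
    by (simp add: bounded_operators_def scaleC_scaleC mult.commute flip: scaleC_of_real)
  then show "r *\<^sub>R a \<in> bounded_operators"
    by (simp add: bounded_operators_def blinfun.scaleR_left)
qed (simp_all add: bounded_operators_def blinfun.add_left scaleC_add_right)

section \<open>Projection-valued measures and their scalar measures\<close>

lemma pvm_orthogonal_projection:
  "projection_valued_measure E \<Longrightarrow> B \<in> sets borel \<Longrightarrow> orthogonal_projection (E B)"
  by (simp add: projection_valued_measure_def projection_iff)

lemma pvm_Int: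
  assumes "projection_valued_measure E" "A \<in> sets borel" "B \<in> sets borel"
  shows "blinfun_apply (E A) (blinfun_apply (E B) v) = blinfun_apply (E (A \<inter> B)) v"
  using assms by (simp add: projection_valued_measure_def)

text \<open>The constant family of empty sets is disjoint, and a convergent series with constant
  terms has zero terms.\<close>

lemma pvm_empty:
  assumes "projection_valued_measure E"
  shows "E {} = 0"
proof (rule blinfun_eqI)
  fix v
  have "(\<lambda>i::nat. E {} v) sums E (\<Union>i::nat. {}) v"
    using assms unfolding projection_valued_measure_def
    by (elim conjE allE[of _ "\<lambda>i::nat. {}"]) (auto simp: disjoint_family_on_def)
  then have "(\<lambda>i::nat. E {} v) \<longlonglongrightarrow> 0"
    by (intro summable_LIMSEQ_zero sums_summable)
  then show "E {} v = (0 :: 'a oper) v"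
    by (simp add: LIMSEQ_const_iff)
qed

lemma sets_scalar_measure [measurable_cong]: "sets (scalar_measure E v) = sets borel"
  and space_scalar_measure: "space (scalar_measure E v) = UNIV"
  unfolding scalar_measure_def
  using sets.sets_measure_of_eq[of borel] sets.space_measure_of_eq[of borel] by simp_all

lemma emeasure_scalar_measure:
  assumes E: "projection_valued_measure E" and B: "B \<in> sets borel"
  shows "emeasure (scalar_measure E v) B = ennreal (inner v (E B v))"
proof -
  have nonneg: "0 \<le> inner v (E A v)" if "A \<in> sets borel" for A
    by (simp add: projection_form[OF pvm_orthogonal_projection[OF E that]])
  have "countably_additive (sets (scalar_measure E v)) (\<lambda>B. ennreal (inner v (E B v)))"
  proof (rule countably_additiveI)
    fix A :: "nat \<Rightarrow> real set"
    assume A: "range A \<subseteq> sets (scalar_measure E v)" "disjoint_family A"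
    then have "(\<lambda>i. E (A i) v) sums E (\<Union>i. A i) v"
      using E by (simp add: projection_valued_measure_def sets_scalar_measure)
    then have "(\<lambda>i. inner v (E (A i) v)) sums inner v (E (\<Union>i. A i) v)"
      by (rule bounded_linear.sums[OF bounded_linear_inner_right])
    moreover have "0 \<le> inner v (E (A i) v)" for i
      using A(1) by (intro nonneg) (auto simp: sets_scalar_measure)
    ultimately show "(\<Sum>i. ennreal (inner v (E (A i) v))) = ennreal (inner v (E (\<Union>i. A i) v))"
      by (rule suminf_ennreal_eq[rotated])
  qed
  moreover have "positive (sets (scalar_measure E v)) (\<lambda>B. ennreal (inner v (E B v)))"
    by (simp add: positive_def pvm_empty[OF E])
  ultimately show ?thesis
    using B by (intro emeasure_measure_of[OF scalar_measure_def[unfolded Re_cinner]])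
      (auto simp: sets_scalar_measure)
qed

lemma measure_scalar_measure:
  assumes "projection_valued_measure E" "B \<in> sets borel"
  shows "measure (scalar_measure E v) B = inner v (E B v)"
  using projection_form[OF pvm_orthogonal_projection[OF assms], of v]
  by (simp add: measure_def emeasure_scalar_measure[OF assms])

lemma pvm_UNIV: "projection_valued_measure E \<Longrightarrow> E UNIV = id_blinfun"
  by (simp add: projection_valued_measure_def)

lemma finite_scalar_measure:
  assumes "projection_valued_measure E"
  shows "finite_measure (scalar_measure E v)"
  by (rule finite_measureI) (simp add: space_scalar_measure emeasure_scalar_measure[OF assms])

lemma pvm_compl:
  assumes E: "projection_valued_measure E" and B: "B \<in> sets borel"
  shows "E (- B) = id_blinfun - E B"
proof (rule symmetric_op_eqI)
  have "- B \<in> sets borel"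
    using B by (metis Compl_eq_Diff_UNIV borel_comp)
  then show "symmetric_op (E (- B))" "symmetric_op (id_blinfun - E B)"
    using pvm_orthogonal_projection[OF E] B
    by (simp_all add: orthogonal_projection_def symmetric_op_algebra)
  fix v
  have "measure (scalar_measure E v) (UNIV - B) =
      measure (scalar_measure E v) UNIV - measure (scalar_measure E v) B"
    using finite_measure.finite_measure_compl[OF finite_scalar_measure[OF E], of B v] B
    by (simp add: space_scalar_measure sets_scalar_measure)
  then show "inner v (E (- B) v) = inner v ((id_blinfun - E B) v)"
    using \<open>- B \<in> sets borel\<close> B
    by (simp add: measure_scalar_measure[OF E] pvm_UNIV[OF E] blinfun.diff_left inner_diff_right
        flip: Compl_eq_Diff_UNIV)
qed

lemma scalar_measure_restrict:
  assumes E: "projection_valued_measure E" and B: "B \<in> sets borel"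
  shows "scalar_measure E (E B v) = density (scalar_measure E v) (indicator B)"
proof (rule measure_eqI)
  fix A
  assume "A \<in> sets (scalar_measure E (E B v))"
  then have A: "A \<in> sets borel"
    by (simp add: sets_scalar_measure)
  have "inner (E B v) (E A (E B v)) = inner v (E (B \<inter> A) v)"
    using A B by (simp add: projection_symmetric[OF pvm_orthogonal_projection[OF E B]]
        pvm_Int[OF E] Int_ac)
  then show "emeasure (scalar_measure E (E B v)) A =
      emeasure (density (scalar_measure E v) (indicator B)) A"
    using A B by (simp add: emeasure_restricted sets_scalar_measure emeasure_scalar_measure[OF E])
qed (simp add: sets_scalar_measure)

lemma AE_scalar_measure:
  assumes E: "projection_valued_measure E" and B: "B \<in> sets borel" and v: "E B v = v"
  shows "AE t in scalar_measure E v. t \<in> B"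
proof (rule AE_I')
  have "- B \<in> sets borel"
    using B by (metis Compl_eq_Diff_UNIV borel_comp)
  then show "- B \<in> null_sets (scalar_measure E v)"
    by (simp add: null_sets_def sets_scalar_measure emeasure_scalar_measure[OF E]
        pvm_compl[OF E B] blinfun.diff_left v)
qed auto

lemma integrable_scalar_measure:
  assumes E: "projection_valued_measure E" and r: "E {-r..r} = id_blinfun"
  shows "integrable (scalar_measure E v) (\<lambda>t. t)"
proof (rule finite_measure.integrable_const_bound[OF finite_scalar_measure[OF E]])
  show "AE t in scalar_measure E v. norm t \<le> r"
    using AE_scalar_measure[OF E, of "{-r..r}" v] by (auto simp: r abs_le_iff)
qed measurable

text \<open>The two parts of \<open>v\<close> have as scalar measures the restrictions to
  \<open>B\<close> and its complement. So the integral form has no cross terms between the range and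
  the kernel of \<open>E B\<close>.\<close>

lemma integral_scalar_measure_split:
  assumes E: "projection_valued_measure E" and r: "E {-r..r} = id_blinfun" and B: "B \<in> sets borel"
  shows "(\<integral>t. t \<partial>scalar_measure E v) =
    (\<integral>t. t \<partial>scalar_measure E (E B v)) + (\<integral>t. t \<partial>scalar_measure E (v - E B v))"
proof -
  let ?M = "scalar_measure E v"
  have C: "- B \<in> sets borel"
    using B by (metis Compl_eq_Diff_UNIV borel_comp)
  have restrict: "(\<integral>t. t \<partial>scalar_measure E (E A v)) = (\<integral>t. indicator A t * t \<partial>?M)"
    and int: "integrable ?M (\<lambda>t. indicator A t * t)" if A: "A \<in> sets borel" for A
  proof -
    show "(\<integral>t. t \<partial>scalar_measure E (E A v)) = (\<integral>t. indicator A t * t \<partial>?M)"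
      using A integral_density[of "\<lambda>t. t" ?M "indicator A :: real \<Rightarrow> real"]
      by (simp add: scalar_measure_restrict[OF E A] ennreal_indicator sets_scalar_measure
          measurable_cong_sets[OF sets_scalar_measure refl])
    show "integrable ?M (\<lambda>t. indicator A t * t)"
      using A integrable_mult_indicator[OF _ integrable_scalar_measure[OF E r], of A v]
      by (simp add: sets_scalar_measure)
  qed
  have "v - E B v = E (- B) v"
    by (simp add: pvm_compl[OF E B] blinfun.diff_left)
  then have "(\<integral>t. t \<partial>scalar_measure E (E B v)) + (\<integral>t. t \<partial>scalar_measure E (v - E B v)) =
      (\<integral>t. indicator B t * t + indicator (- B) t * t \<partial>?M)"
    by (simp add: restrict int B C)
  also have "\<dots> = (\<integral>t. t \<partial>?M)"
    by (intro Bochner_Integration.integral_cong) (auto simp: indicator_def)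
  finally show ?thesis
    by simp
qed

lemma integral_scalar_measure_bounds:
  assumes E: "projection_valued_measure E" and r: "E {-r..r} = id_blinfun"
    and B: "B \<in> sets borel" and v: "E B v = v"
  shows "B \<subseteq> {a..} \<Longrightarrow> a * inner v v \<le> (\<integral>t. t \<partial>scalar_measure E v)"
    and "B \<subseteq> {..b} \<Longrightarrow> (\<integral>t. t \<partial>scalar_measure E v) \<le> b * inner v v"
    and "B \<subseteq> {a<..} \<Longrightarrow> v \<noteq> 0 \<Longrightarrow> a * inner v v < (\<integral>t. t \<partial>scalar_measure E v)"
proof -
  let ?M = "scalar_measure E v"
  interpret finite_measure ?M
    by (rule finite_scalar_measure[OF E])
  have AE: "AE t in ?M. t \<in> B"
    by (rule AE_scalar_measure[OF E B v])
  have int: "integrable ?M (\<lambda>t. t)"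
    by (rule integrable_scalar_measure[OF E r])
  have const: "(\<integral>t. c \<partial>?M) = c * inner v v" for c :: real
    by (simp add: space_scalar_measure measure_scalar_measure[OF E] pvm_UNIV[OF E])
  show "a * inner v v \<le> (\<integral>t. t \<partial>?M)" if "B \<subseteq> {a..}" for a
    unfolding const[symmetric] by (rule integral_mono_AE) (use AE int that in auto)
  show "(\<integral>t. t \<partial>?M) \<le> b * inner v v" if "B \<subseteq> {..b}" for b
    unfolding const[symmetric] by (rule integral_mono_AE) (use AE int that in auto)
  show "a * inner v v < (\<integral>t. t \<partial>?M)" if "B \<subseteq> {a<..}" "v \<noteq> 0" for a
  \<comment> \<open>An almost everywhere positive function with nonpositive integral forces total
    mass zero, and the total mass is \<open>inner v v\<close>.\<close>
  proof (rule ccontr)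
    assume "\<not> ?thesis"
    then have le: "(\<integral>t. t - a \<partial>?M) \<le> 0"
      unfolding Bochner_Integration.integral_diff[OF int integrable_const] const by simp
    have pos: "AE t in ?M. 0 < t - a"
      using AE by eventually_elim (use that in auto)
    then have "AE t in ?M. 0 \<le> t - a"
      by eventually_elim simp
    moreover have "integrable ?M (\<lambda>t. t - a)"
      using int by simp
    ultimately have "AE t in ?M. t - a = 0"
      using le by (metis integral_nonneg_AE integral_nonneg_eq_0_iff_AE order_antisym)
    with pos have "AE t in ?M. False"
      by eventually_elim simp
    then have "measure ?M UNIV = 0"
      using AE_iff_measurable[of UNIV ?M] by (simp add: space_scalar_measure sets_scalar_measure measure_def)
    then show False
      using that by (simp add: measure_scalar_measure[OF E] pvm_UNIV[OF E])
  qed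
qed

section \<open>From spectral cuts to a spectral resolution\<close>

lemma projection_block_form:
  assumes p: "orthogonal_projection p" and commute: "p o\<^sub>L a = a o\<^sub>L p"
  shows "inner v (a v) = inner (p v) (a (p v)) + inner (v - p v) (a (v - p v))"
proof -
  have a_p: "a (p w) = p (a w)" for w
    by (rule blinfun_compose_eqD[OF commute[symmetric]])
  have "inner (p v) (p w) = inner (p v) w" for w
    by (simp add: projection_symmetric[OF p] projection_idem[OF p])
  then show ?thesis
    by (simp add: blinfun.diff_right a_p inner_diff_left inner_diff_right)
      (simp add: projection_symmetric[OF p] projection_idem[OF p])
qed

lemma pvm_id_mono:
  assumes E: "projection_valued_measure E" and "A \<in> sets borel" "B \<in> sets borel"
    and "A \<subseteq> B" and A: "E A = id_blinfun"
  shows "E B = id_blinfun"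
proof (rule blinfun_eqI)
  fix v
  have "E B (E A v) = E (B \<inter> A) v"
    by (rule pvm_Int[OF E assms(3,2)])
  then show "E B v = id_blinfun v"
    using A \<open>A \<subseteq> B\<close> by (simp add: Int_absorb1)
qed

lemma pvm_greaterThan:
  assumes "projection_valued_measure E"
  shows "blinfun_apply (E {t<..}) v = v - blinfun_apply (E {..t}) v"
  using pvm_compl[OF assms, of "{..t}"] by (simp add: blinfun.diff_left)

lemma pvm_atLeast:
  assumes "projection_valued_measure E"
  shows "blinfun_apply (E {t..}) v = v - blinfun_apply (E {..<t}) v"
  using pvm_compl[OF assms, of "{..<t}"] by (simp add: blinfun.diff_left)

text \<open>On the range of \<open>E {a<..b}\<close> the form of \<open>x\<close> and the integral
  form both lie between \<open>a\<close> and \<open>b\<close> times the squared norm. Both split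
  along cuts, so refining the partition forces them to agree.\<close>

lemma spectral_resolution_if_cuts:
  assumes E: "projection_valued_measure E" and sa: "selfadjoint x"
    and cut: "\<And>t. spectral_cut x t (E {..t})"
  shows "spectral_resolution x E"
proof -
  note Int = pvm_Int[OF E]
  \<comment> \<open>The extra 1 puts \<open>- r\<close> strictly below \<open>- norm x\<close>, as
    the vanishing of the cut at \<open>- r\<close> requires.\<close>
  define r where "r = norm x + 1"
  have r: "E {-r..r} = id_blinfun"
  proof (rule blinfun_eqI)
    fix v
    have "E {..-r} w = 0" for w
      by (rule spectral_cut_below_norm[OF cut]) (simp add: r_def)
    moreover have "E {..<-r} v = E {..-r} (E {..<-r} v)"
      by (simp add: Int Int_absorb1 subset_iff)
    ultimately have "E {..<-r} v = 0"
      by simp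
    then have "E {-r..} v = v"
      by (simp add: pvm_atLeast[OF E])
    moreover have "E {..r} v = v"
      by (rule spectral_cut_above_norm[OF cut]) (simp add: r_def)
    moreover have "{-r..r} = {..r} \<inter> {-r..}"
      by auto
    ultimately show "E {-r..r} v = id_blinfun v"
      using Int[of "{..r}" "{-r..}" v] by simp
  qed
  \<comment> \<open>\<open>D\<close> is additive along \<open>E\<close>, so its bound on the range of \<open>E {a<..b}\<close> halves with each bisection.\<close>
  define D where "D v = inner v (x v) - (\<integral>t. t \<partial>scalar_measure E v)" for v
  have bisect: "\<bar>D v\<bar> \<le> (b - a) / 2 ^ k * inner v v" if "a \<le> b" "E {a<..b} v = v" for a b v k
    using that
  proof (induction k arbitrary: a b v)
    case 0
    have "E {..b} v = v"
      using Int[of "{..b}" "{a<..b}" v] 0 by (simp add: Int_absorb1 subset_iff)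
    then have "inner v (x v) \<le> b * inner v v"
      using cut[of b] by (simp add: spectral_cut_def)
    moreover have "{..a} \<inter> {a<..b} = {}"
      by auto
    then have "E {..a} v = 0"
      using Int[of "{..a}" "{a<..b}" v] 0 by (simp add: pvm_empty[OF E])
    then have "a * inner v v \<le> inner v (x v)"
      using cut[of a] by (cases "v = 0") (simp_all add: spectral_cut_def less_imp_le)
    moreover have "a * inner v v \<le> (\<integral>t. t \<partial>scalar_measure E v)"
      "(\<integral>t. t \<partial>scalar_measure E v) \<le> b * inner v v"
      by (rule integral_scalar_measure_bounds[OF E r _ 0(2)]; auto)+
    ultimately show ?case
      by (simp add: D_def abs_le_iff algebra_simps)
  next
    case (Suc k)
    define m where "m = (a + b) / 2"
    define v\<^sub>1 where "v\<^sub>1 = E {..m} v"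
    define v\<^sub>2 where "v\<^sub>2 = v - v\<^sub>1"
    have m: "a \<le> m" "m \<le> b" "m - a = (b - a) / 2" "b - m = (b - a) / 2"
      using Suc.prems(1) by (auto simp: m_def field_simps)
    have proj: "orthogonal_projection (E {..m})"
      by (rule pvm_orthogonal_projection[OF E]) simp
    have "v\<^sub>1 = E ({..m} \<inter> {a<..b}) v"
      using Int[of "{..m}" "{a<..b}" v] Suc.prems(2) by (simp add: v\<^sub>1_def)
    moreover have "{..m} \<inter> {a<..b} = {a<..m}"
      using m by auto
    ultimately have v\<^sub>1: "E {a<..m} v\<^sub>1 = v\<^sub>1"
      by (simp add: Int)
    have "v\<^sub>2 = E ({m<..} \<inter> {a<..b}) v"
      using Int[of "{m<..}" "{a<..b}" v] Suc.prems(2)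
      by (simp add: v\<^sub>1_def v\<^sub>2_def pvm_greaterThan[OF E])
    moreover have "{m<..} \<inter> {a<..b} = {m<..b}"
      using m by auto
    ultimately have v\<^sub>2: "E {m<..b} v\<^sub>2 = v\<^sub>2"
      by (simp add: Int)
    have "D v = D v\<^sub>1 + D v\<^sub>2"
      using projection_block_form[OF proj, of x v] cut[of m]
        integral_scalar_measure_split[OF E r, of "{..m}" v]
      by (simp add: D_def v\<^sub>1_def v\<^sub>2_def spectral_cut_def)
    moreover have "\<bar>D v\<^sub>1\<bar> \<le> (b - a) / 2 ^ Suc k * inner v\<^sub>1 v\<^sub>1"
      using Suc.IH[OF m(1) v\<^sub>1] by (simp add: m(3))
    moreover have "\<bar>D v\<^sub>2\<bar> \<le> (b - a) / 2 ^ Suc k * inner v\<^sub>2 v\<^sub>2"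
      using Suc.IH[OF m(2) v\<^sub>2] by (simp add: m(4))
    moreover have "inner v v = inner v\<^sub>1 v\<^sub>1 + inner v\<^sub>2 v\<^sub>2"
      using projection_pythagoras[OF proj, of v] by (simp add: v\<^sub>1_def v\<^sub>2_def power2_norm_eq_inner)
    then have "(b - a) / 2 ^ Suc k * inner v v =
        (b - a) / 2 ^ Suc k * inner v\<^sub>1 v\<^sub>1 + (b - a) / 2 ^ Suc k * inner v\<^sub>2 v\<^sub>2"
      by (simp only: distrib_left)
    ultimately show ?case
      by linarith
  qed
  have "D v = 0" for v
  proof -
    have "0 \<le> r"
      by (simp add: r_def)
    \<comment> \<open>Bisection uses intervals open on the left, so the left end is moved to keep
      \<open>- r\<close> inside.\<close>
    have "E {-r - 1<..r} = id_blinfun"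
      by (rule pvm_id_mono[OF E _ _ _ r]) auto
    then have le: "\<bar>D v\<bar> \<le> (r - (- r - 1)) / 2 ^ k * inner v v" for k
      using \<open>0 \<le> r\<close> by (intro bisect) simp_all
    have "(\<lambda>k. (r - (- r - 1)) * inner v v * (1 / 2) ^ k) \<longlonglongrightarrow> (r - (- r - 1)) * inner v v * 0"
      by (intro tendsto_intros LIMSEQ_realpow_zero) simp_all
    then have "\<bar>D v\<bar> \<le> (r - (- r - 1)) * inner v v * 0"
      by (rule LIMSEQ_le_const) (use le in \<open>auto simp: field_simps\<close>)
    then show ?thesis
      by simp
  qed
  then show ?thesis
    using E r unfolding spectral_resolution_def
    by (auto simp: cinner_selfadjoint[OF sa] D_def)
qed

section \<open>Uniqueness of the spectral resolution\<close>

lemma spectral_resolution_form: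
  assumes "spectral_resolution x E"
  shows "inner v (x v) = (\<integral>t. t \<partial>scalar_measure E v)"
  using assms by (metis Re_cinner Re_complex_of_real spectral_resolution_def)

text \<open>The block-diagonal part \<open>y\<close> of \<open>x\<close> with respect to
  \<open>E B\<close> has the same form as \<open>x\<close>, because the integral form splits along
  \<open>B\<close>. Hence \<open>x = y\<close>, and \<open>y\<close> commutes with
  \<open>E B\<close>.\<close>

lemma spectral_resolution_commute:
  assumes sym: "symmetric_op x" and res: "spectral_resolution x E" and B: "B \<in> sets borel"
  shows "E B o\<^sub>L x = x o\<^sub>L E B"
proof -
  obtain r where E: "projection_valued_measure E" and r: "E {-r..r} = id_blinfun"
    using res by (auto simp: spectral_resolution_def)
  define p where "p = E B"
  have p: "orthogonal_projection p"
    unfolding p_def by (rule pvm_orthogonal_projection[OF E B])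
  define y where "y = (p o\<^sub>L x o\<^sub>L p) + ((id_blinfun - p) o\<^sub>L x o\<^sub>L (id_blinfun - p))"
  have y: "y v = p (x (p v)) + (x (v - p v) - p (x (v - p v)))" for v
    by (simp add: y_def blinfun.bilinear_simps)
  have "x = y"
  proof (rule symmetric_op_eqI[OF sym])
    show "symmetric_op y"
      unfolding symmetric_op_def y
      by (simp add: blinfun.diff_right inner_simps projection_symmetric[OF p] symmetric_opD[OF sym])
    show "inner v (x v) = inner v (y v)" for v
      using integral_scalar_measure_split[OF E r B, of v]
      unfolding spectral_resolution_form[OF res, symmetric] p_def[symmetric] y
      by (simp add: inner_add_right inner_diff_right inner_diff_left projection_symmetric[OF p])
  qed
  then have "x v = p (x (p v)) + (x (v - p v) - p (x (v - p v)))" for v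
    using y by metis
  from this[of "p v" for v] have "x (p v) = p (x (p v))" for v
    by (simp add: projection_idem[OF p])
  moreover have "p (x v) = p (x (p v))" for v
    using arg_cong[OF \<open>x v = _\<close>, of p for v]
    by (simp add: blinfun.add_right blinfun.diff_right projection_idem[OF p])
  ultimately show ?thesis
    unfolding p_def[symmetric] by (intro blinfun_eqI) simp
qed

lemma spectral_resolution_bounds:
  assumes res: "spectral_resolution x E" and B: "B \<in> sets borel" and v: "E B v = v"
  shows "B \<subseteq> {a..} \<Longrightarrow> a * inner v v \<le> inner v (x v)"
    and "B \<subseteq> {..b} \<Longrightarrow> inner v (x v) \<le> b * inner v v"
    and "B \<subseteq> {a<..} \<Longrightarrow> v \<noteq> 0 \<Longrightarrow> a * inner v v < inner v (x v)"
proof -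
  obtain r where "projection_valued_measure E" "E {-r..r} = id_blinfun"
    using res by (auto simp: spectral_resolution_def)
  note bounds = integral_scalar_measure_bounds[OF this B v, folded spectral_resolution_form[OF res]]
  show "B \<subseteq> {a..} \<Longrightarrow> a * inner v v \<le> inner v (x v)"
    "B \<subseteq> {..b} \<Longrightarrow> inner v (x v) \<le> b * inner v v"
    "B \<subseteq> {a<..} \<Longrightarrow> v \<noteq> 0 \<Longrightarrow> a * inner v v < inner v (x v)"
    by (fact bounds)+
qed

text \<open>Any resolution thus takes on half-lines the values that \<open>x\<close> alone
  determines by \<open>spectral_cut_unique\<close>.\<close>

lemma spectral_resolution_cut:
  assumes sym: "symmetric_op x" and res: "spectral_resolution x E"
  shows "spectral_cut x t (E {..t})"
  unfolding spectral_cut_def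
proof (intro conjI allI impI)
  have E: "projection_valued_measure E"
    using res by (simp add: spectral_resolution_def)
  show "orthogonal_projection (E {..t})"
    by (simp add: pvm_orthogonal_projection[OF E])
  show "E {..t} o\<^sub>L x = x o\<^sub>L E {..t}"
    by (simp add: spectral_resolution_commute[OF sym res])
  show "inner v (x v) \<le> t * inner v v" if "E {..t} v = v" for v
    using spectral_resolution_bounds(2)[OF res _ that] by simp
  show "t * inner v v < inner v (x v)" if "E {..t} v = 0" "v \<noteq> 0" for v
  proof -
    have "E {t<..} v = v"
      by (simp add: pvm_greaterThan[OF E] that)
    then show ?thesis
      using spectral_resolution_bounds(3)[OF res, of "{t<..}"] that by simp
  qed
qed

lemma spectral_resolution_unique:
  assumes sym: "symmetric_op x" and E: "spectral_resolution x E" and E': "spectral_resolution x E'"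
    and B: "B \<in> sets borel"
  shows "E B = E' B"
proof (rule symmetric_op_eqI)
  have pvm: "projection_valued_measure E" "projection_valued_measure E'"
    using E E' by (simp_all add: spectral_resolution_def)
  show "symmetric_op (E B)" "symmetric_op (E' B)"
    using pvm B pvm_orthogonal_projection by (auto simp: orthogonal_projection_def)
  fix v
  have atMost: "E {..t} = E' {..t}" for t
    using spectral_cut_unique[OF sym spectral_resolution_cut[OF sym E]
        spectral_resolution_cut[OF sym E']] .
  have borel: "sets borel = sigma_sets UNIV (range (\<lambda>t::real. {..t}))"
    by (subst borel_eq_atMost) simp
  have "scalar_measure E v = scalar_measure E' v"
  proof (rule measure_eqI_generator_eq[where A = "\<lambda>n. {..real n}"])
    show "Int_stable (range (\<lambda>t::real. {..t}))"
      by (auto simp: Int_stable_def)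
    show "(\<Union>n. {..real n}) = UNIV"
      by (auto simp: real_arch_simple)
    show "emeasure (scalar_measure E v) X = emeasure (scalar_measure E' v) X"
      if "X \<in> range (\<lambda>t::real. {..t})" for X
      using that pvm by (auto simp: emeasure_scalar_measure atMost)
  qed (use borel pvm in \<open>auto simp: sets_scalar_measure emeasure_scalar_measure\<close>)
  then show "inner v (E B v) = inner v (E' B v)"
    using measure_scalar_measure[OF pvm(1) B] measure_scalar_measure[OF pvm(2) B] by metis
qed

text \<open>Additivity of the forms gives additivity of \<open>E\<close>, and disjoint sets give
  orthogonal ranges. Decomposing \<open>A\<close> and \<open>B\<close> along
  \<open>A \<inter> B\<close> then yields the product rule.\<close>

lemma projection_valued_measure_if_form:
  assumes fin: "\<And>v. finite_measure (\<mu> v)" and sets: "\<And>v. sets (\<mu> v) = sets borel"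
    and UNIV: "\<And>v. measure (\<mu> v) UNIV = inner v v"
    and proj: "\<And>B. B \<in> sets borel \<Longrightarrow> projection (E B)"
    and form: "\<And>B v. B \<in> sets borel \<Longrightarrow> inner v (blinfun_apply (E B) v) = measure (\<mu> v) B"
  shows "projection_valued_measure E"
  unfolding projection_valued_measure_def
proof (intro conjI ballI allI impI)
  have orth: "orthogonal_projection (E B)" if "B \<in> sets borel" for B
    using proj[OF that] by (simp add: projection_iff)
  have sym: "symmetric_op (E B)" if "B \<in> sets borel" for B
    using orth[OF that] by (simp add: orthogonal_projection_def)
  have mono: "measure (\<mu> v) A \<le> measure (\<mu> v) B" if "A \<subseteq> B" "B \<in> sets borel" for A B v
    using that by (intro finite_measure.finite_measure_mono[OF fin]) (simp_all add: sets)
  have add: "measure (\<mu> v) (A \<union> B) = measure (\<mu> v) A + measure (\<mu> v) B"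
    if "A \<in> sets borel" "B \<in> sets borel" "A \<inter> B = {}" for A B v
    using that by (intro finite_measure.finite_measure_Union[OF fin]) (simp_all add: sets)
  have union: "E (A \<union> B) = E A + E B"
    if "A \<in> sets borel" "B \<in> sets borel" "A \<inter> B = {}" for A B
    using that
    by (intro symmetric_op_eqI) (simp_all add: sym symmetric_op_algebra form add blinfun.add_left inner_add_right)
  have split: "E C = E (C \<inter> D) + E (C - D)" if "C \<in> sets borel" "D \<in> sets borel" for C D
  proof -
    have "E ((C \<inter> D) \<union> (C - D)) = E (C \<inter> D) + E (C - D)"
      by (rule union) (use that in auto)
    then show ?thesis
      unfolding Int_Diff_Un .
  qed
  have disjoint: "E B (E A v) = 0"
    if "A \<in> sets borel" "B \<in> sets borel" "A \<inter> B = {}" for A B v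
  proof (rule projection_orthogonal[OF orth orth])
    fix v
    have "measure (\<mu> v) (A \<union> B) \<le> measure (\<mu> v) UNIV"
      by (rule mono) simp_all
    then show "inner v (E A v) + inner v (E B v) \<le> inner v v"
      using that by (simp add: form add UNIV)
  qed (use that in auto)
  show "projection (E B)" if "B \<in> sets borel" for B
    by (rule proj[OF that])
  show "E UNIV = id_blinfun"
    by (rule symmetric_op_eqI) (simp_all add: sym symmetric_op_algebra form UNIV)
  show "E (A \<inter> B) = E A o\<^sub>L E B" if A: "A \<in> sets borel" and B: "B \<in> sets borel" for A B
  proof (rule blinfun_eqI)
    fix v
    have "E A w = E (A \<inter> B) w + E (A - B) w" "E B w = E (A \<inter> B) w + E (B - A) w" for w
      by (metis A B blinfun.add_left split) (metis A B Int_commute blinfun.add_left split)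
    note eqs = this
    have zeros: "E (A \<inter> B) (E (B - A) v) = 0" "E (A - B) (E (A \<inter> B) v) = 0"
      "E (A - B) (E (B - A) v) = 0"
      using A B by (auto intro!: disjoint)
    have "E (A \<inter> B) (E (A \<inter> B) v) = E (A \<inter> B) v"
      using A B by (intro projection_idem orth) simp
    then show "E (A \<inter> B) v = (E A o\<^sub>L E B) v"
      by (simp only: blinfun_apply_blinfun_compose eqs blinfun.add_right zeros add_0_right)
  qed
  show "(\<lambda>i. E (A i) v) sums E (\<Union>i. A i) v"
    if A: "range A \<subseteq> sets borel" and disj: "disjoint_family A" for A v
  proof -
    define U where "U n = (\<Union>i<n. A i)" for n
    have A_sets: "A i \<in> sets borel" for i
      using A by auto
    have U_sets: "U n \<in> sets borel" "(\<Union>i. A i) \<in> sets borel" for n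
      using A_sets by (auto simp: U_def)
    have E_U: "(\<Sum>i<n. E (A i) v) = E (U n) v" for n
    proof (induction n)
      case 0
      have "E {} = 0"
        by (rule symmetric_op_eqI) (simp_all add: sym symmetric_op_algebra form)
      then show ?case
        by (simp add: U_def)
    next
      case (Suc n)
      have "A i \<inter> A n = {}" if "i < n" for i
        using disj that by (simp add: disjoint_family_on_def)
      then have "U n \<inter> A n = {}"
        unfolding U_def by blast
      then have "E (U n \<union> A n) = E (U n) + E (A n)"
        by (intro union U_sets A_sets)
      moreover have "U (Suc n) = U n \<union> A n"
        by (auto simp: U_def lessThan_Suc)
      ultimately show ?case
        by (simp add: Suc blinfun.add_left)
    qed
    have "(\<lambda>i. measure (\<mu> v) (A i)) sums measure (\<mu> v) (\<Union>i. A i)"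
      using A disj by (intro finite_measure.finite_measure_UNION[OF fin]) (simp_all add: sets)
    moreover have "(\<Sum>i<n. measure (\<mu> v) (A i)) = measure (\<mu> v) (U n)" for n
      using arg_cong[OF E_U[of n], of "inner v"] by (simp add: inner_sum_right form A_sets U_sets)
    ultimately have lim: "(\<lambda>n. measure (\<mu> v) (U n)) \<longlonglongrightarrow> measure (\<mu> v) (\<Union>i. A i)"
      by (simp add: sums_def)
    \<comment> \<open>The squared norm of the remainder is a scalar measure difference, so scalar
      countable additivity gives strong countable additivity.\<close>
    have "(norm (E (\<Union>i. A i) v - E (U n) v))\<^sup>2 = measure (\<mu> v) (\<Union>i. A i) - measure (\<mu> v) (U n)" for n
    proof -
      have "U n \<subseteq> (\<Union>i. A i)"
        by (auto simp: U_def)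
      then have "E (\<Union>i. A i) (E (U n) w) = E (U n) w" for w
        using U_sets by (intro projection_le_imp_absorb orth) (simp_all add: form mono)
      from projection_norm_diff[OF orth orth this] show ?thesis
        using U_sets by (simp add: form)
    qed
    then have "(\<lambda>n. (norm (E (\<Union>i. A i) v - E (U n) v))\<^sup>2) \<longlonglongrightarrow> 0"
      using tendsto_diff[OF tendsto_const lim, of "measure (\<mu> v) (\<Union>i. A i)"] by simp
    then have "(\<lambda>n. sqrt ((norm (E (\<Union>i. A i) v - E (U n) v))\<^sup>2)) \<longlonglongrightarrow> sqrt 0"
      by (rule tendsto_real_sqrt)
    then have "(\<lambda>n. E (\<Union>i. A i) v - E (U n) v) \<longlonglongrightarrow> 0"
      by (simp add: tendsto_norm_zero_iff)
    from tendsto_diff[OF tendsto_const this, of "E (\<Union>i. A i) v"] show ?thesis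
      by (simp add: sums_def E_U)
  qed
qed

lemma spectral_theorem:
  assumes "selfadjoint x"
  shows "\<exists>E. spectral_resolution x E \<and>
    (\<forall>N. strong_algebra N \<longrightarrow> x \<in> N \<longrightarrow> (\<forall>B \<in> sets borel. E B \<in> N))"
proof -
  have bdd: "x \<in> bounded_operators" and sym: "symmetric_op x"
    using assms by (simp_all add: selfadjoint_iff)
  obtain E \<mu> where \<mu>: "\<And>v. finite_measure (\<mu> v)" "\<And>v. sets (\<mu> v) = sets borel"
      "\<And>v. measure (\<mu> v) UNIV = inner v v"
    and E: "\<And>B. B \<in> sets borel \<Longrightarrow> orthogonal_projection (E B)"
      "\<And>B v. B \<in> sets borel \<Longrightarrow> inner v (E B v) = measure (\<mu> v) B"
      "\<And>B N. B \<in> sets borel \<Longrightarrow> strong_algebra N \<Longrightarrow> x \<in> N \<Longrightarrow> E B \<in> N"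
    and cut: "\<And>t. spectral_cut x t (E {..t})"
    using borel_projections_exist[OF sym] by blast
  have "projection (E B)" if "B \<in> sets borel" for B
    using E(1,3)[OF that] bdd strong_algebra_bounded_operators by (simp add: projection_iff)
  then have "projection_valued_measure E"
    using \<mu> E(2) by (intro projection_valued_measure_if_form[of \<mu>])
  then show ?thesis
    using spectral_resolution_if_cuts[OF _ assms cut] E(3) by blast
qed

text \<open>Resolves the definite description: uniqueness at the single Borel set \<open>B\<close>
  is what it asks for.\<close>

lemma spectral_projection_eq:
  assumes "selfadjoint x" "spectral_resolution x E" "B \<in> sets borel"
  shows "spectral_projection x B = E B"
  unfolding spectral_projection_def
proof (rule the_equality)
  show "\<exists>E'. spectral_resolution x E' \<and> E B = E' B"
    using assms by blast
  show "p = E B" if "\<exists>E'. spectral_resolution x E' \<and> p = E' B" for p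
    using that assms spectral_resolution_unique by (auto simp: selfadjoint_iff)
qed

lemma spectral_projection_mem:
  assumes "selfadjoint x" "B \<in> sets borel" "strong_algebra N" "x \<in> N"
  shows "spectral_projection x B \<in> N"
  using spectral_theorem[OF assms(1)] spectral_projection_eq[OF assms(1) _ assms(2)] assms by metis

lemma projection_spectral_projection:
  assumes "selfadjoint x" "B \<in> sets borel"
  shows "projection (spectral_projection x B)"
proof -
  obtain E where E: "spectral_resolution x E"
    using spectral_theorem[OF assms(1)] by blast
  then show ?thesis
    using assms(2) unfolding spectral_projection_eq[OF assms(1) E assms(2)]
    by (simp add: spectral_resolution_def projection_valued_measure_def)
qed

lemma spectral_projection_commute:
  assumes "selfadjoint x" "B \<in> sets borel" and commute: "x o\<^sub>L y = y o\<^sub>L x"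
  shows "spectral_projection x B o\<^sub>L y = y o\<^sub>L spectral_projection x B"
  using spectral_projection_mem[OF assms(1,2) strong_algebra_commutant[of y]] commute by simp

lemma spectral_projection_Int:
  assumes "selfadjoint x" "A \<in> sets borel" "B \<in> sets borel"
  shows "spectral_projection x A (spectral_projection x B v) = spectral_projection x (A \<inter> B) v"
proof -
  obtain E where E: "spectral_resolution x E"
    using spectral_theorem[OF assms(1)] by blast
  then have "projection_valued_measure E"
    by (simp add: spectral_resolution_def)
  then show ?thesis
    using assms by (simp add: spectral_projection_eq[OF _ E] pvm_Int)
qed

lemma spectral_projection_greaterThan:
  assumes sa: "selfadjoint x" and v: "spectral_projection x {t<..} v = v" and "v \<noteq> 0"
  shows "t * inner v v < inner v (x v)"
proof -
  obtain E where E: "spectral_resolution x E"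
    using spectral_theorem[OF sa] by blast
  then have "E {t<..} v = v"
    using v by (simp add: spectral_projection_eq[OF sa])
  then show ?thesis
    using spectral_resolution_bounds(3)[OF E, of "{t<..}"] \<open>v \<noteq> 0\<close> by simp
qed

lemma spectral_projection_greaterThan_eq_0:
  assumes sa: "selfadjoint x" and v: "spectral_projection x {t<..} v = 0"
  shows "inner v (x v) \<le> t * inner v v"
proof -
  obtain E where E: "spectral_resolution x E"
    using spectral_theorem[OF sa] by blast
  then have "projection_valued_measure E"
    by (simp add: spectral_resolution_def)
  from pvm_greaterThan[OF this, of t v] have "E {..t} v = v"
    using v E by (simp add: spectral_projection_eq[OF sa])
  then show ?thesis
    using spectral_resolution_bounds(2)[OF E, of "{..t}"] by simp
qed

lemma spectral_below_perp_commute: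
  assumes "selfadjoint x" and commute: "x o\<^sub>L y = y o\<^sub>L x"
  shows "spectral_below_perp t x o\<^sub>L y = y o\<^sub>L spectral_below_perp t x"
proof -
  have "spectral_projection x {..<t} o\<^sub>L y = y o\<^sub>L spectral_projection x {..<t}"
    by (rule spectral_projection_commute[OF assms(1) _ commute]) simp
  from blinfun_compose_eqD[OF this] show ?thesis
    by (auto intro!: blinfun_eqI
        simp: spectral_below_perp_def spectral_below_def blinfun.diff_left blinfun.diff_right)
qed

lemma projection_spectral_below_perp:
  assumes "selfadjoint x"
  shows "projection (spectral_below_perp t x)"
  using projection_spectral_projection[OF assms, of "{..<t}"]
  by (simp add: spectral_below_perp_def spectral_below_def projection_iff projection_complement
      strong_algebra.diff strong_algebra.one strong_algebra_bounded_operators)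

lemma spectral_below_perp_ge:
  assumes sa: "selfadjoint x" and v: "spectral_below_perp t x v = v"
  shows "t * inner v v \<le> inner v (x v)"
proof -
  obtain E where E: "spectral_resolution x E"
    using spectral_theorem[OF sa] by blast
  then have "projection_valued_measure E"
    by (simp add: spectral_resolution_def)
  from pvm_atLeast[OF this, of t v] have "E {t..} v = v"
    using v E by (simp add: spectral_below_perp_def spectral_below_def spectral_projection_eq[OF sa]
        blinfun.diff_left)
  then show ?thesis
    using spectral_resolution_bounds(1)[OF E, of "{t..}"] by simp
qed

section \<open>The maximal inequality\<close>

lemma (in von_neumann_algebra) scaleR_mem: "a \<in> M \<Longrightarrow> r *\<^sub>R a \<in> M"
proof -
  assume "a \<in> M"
  moreover have "r *\<^sub>R a = scaleC_oper (complex_of_real r) a"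
    by (rule blinfun_eqI) (simp add: scaleC_oper.rep_eq scaleC_of_real blinfun.scaleR_left)
  ultimately show ?thesis
    by (simp add: scaleC_mem)
qed

lemma (in von_neumann_algebra) strong_algebra: "strong_algebra M"
proof
  fix A :: "nat \<Rightarrow> 'h oper" and a :: "'h oper"
  assume A: "\<And>n. A n \<in> M" and lim: "\<And>v. (\<lambda>n. A n v) \<longlonglongrightarrow> a v"
  have "openin strong_operator_topology (- M)"
    using strongly_closed
    by (simp add: closedin_def strong_operator_topology_topspace Compl_eq_Diff_UNIV)
  \<comment> \<open>The strong operator topology is the pullback of the product topology along
    \<open>blinfun_apply\<close>, in which convergence is pointwise; a limit outside
    \<open>M\<close> would pull some \<open>A n\<close> outside.\<close>
  then obtain U where U: "open U" "- M = blinfun_apply -` U"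
    by (auto simp: strong_operator_topology_def openin_pullback_topology)
  have "(\<lambda>n. blinfun_apply (A n)) \<longlonglongrightarrow> blinfun_apply a"
    using limitin_componentwise[of "\<lambda>_. euclidean" UNIV "\<lambda>n. blinfun_apply (A n)" "blinfun_apply a"] lim
    by (simp add: euclidean_product_topology)
  then have "\<exists>n. blinfun_apply (A n) \<in> U" if "blinfun_apply a \<in> U"
    using topological_tendstoD[OF _ U(1) that] eventually_happens by fastforce
  then show "a \<in> M"
    using A U(2) by blast
qed (simp_all add: one_mem add_mem scaleR_mem mult_mem)

lemma selfadjoint_sum:
  "(\<And>i. i \<in> I \<Longrightarrow> selfadjoint (y i)) \<Longrightarrow> selfadjoint (\<Sum>i\<in>I. y i)"
proof (induction I rule: infinite_finite_induct)
qed (simp_all add: selfadjoint_iff symmetric_op_algebra strong_algebra.zero strong_algebra.add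
    strong_algebra_bounded_operators)

text \<open>Serves to place the projections of \<open>s k\<close> and \<open>s n - s k\<close> in
  the algebras of an initial and a final block of variables.\<close>

lemma spectral_projection_generated:
  assumes "selfadjoint (\<Sum>i\<in>I. y i)" "I \<subseteq> J" "B \<in> sets borel"
  shows "spectral_projection (\<Sum>i\<in>I. y i) B \<in> W* (y ` J)"
  unfolding generated_vna_def
proof (rule InterI, safe)
  fix N
  assume N: "von_neumann_algebra N" "y ` J \<subseteq> N"
  interpret strong_algebra N
    using N(1) by (rule von_neumann_algebra.strong_algebra)
  have "(\<Sum>i\<in>I. y i) \<in> N"
    using N(2) \<open>I \<subseteq> J\<close> by (induction I rule: infinite_finite_induct) (auto simp: zero add)
  then show "spectral_projection (\<Sum>i\<in>I. y i) B \<in> N"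
    using assms by (intro spectral_projection_mem strong_algebra_axioms)
qed

lemma id_diff_generated:
  assumes "a \<in> W* S"
  shows "id_blinfun - a \<in> W* S"
  using assms unfolding generated_vna_def
  by (auto intro!: strong_algebra.diff strong_algebra.one von_neumann_algebra.strong_algebra)

context tracial_von_neumann_algebra
begin

lemma trace_projection:
  assumes "p \<in> M" "projection p"
  shows "\<tau> p = complex_of_real (Re (\<tau> p))" "0 \<le> Re (\<tau> p)"
proof -
  have "cadjoint p o\<^sub>L p = p"
    using assms by (simp add: projection_def selfadjoint_def)
  then have "\<tau> p \<in> \<real>\<^sub>\<ge>\<^sub>0"
    using trace_positive[OF assms(1)] by simp
  then show "\<tau> p = complex_of_real (Re (\<tau> p))" "0 \<le> Re (\<tau> p)"
    by (auto simp: nonneg_Reals_def)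
qed

lemma trace_projection_mono:
  assumes p: "p \<in> M" "projection p" and q: "q \<in> M" "projection q"
    and absorb: "\<And>v. blinfun_apply q (blinfun_apply p v) = blinfun_apply p v"
  shows "Re (\<tau> p) \<le> Re (\<tau> q)"
proof -
  have mem: "q - p \<in> M"
    using strong_algebra.diff[OF strong_algebra] p q by blast
  moreover have "projection (q - p)"
    using projection_diff[OF _ _ absorb] p q mem subset_bounded_operators
    by (auto simp: projection_iff)
  ultimately have "0 \<le> Re (\<tau> (q - p))"
    by (rule trace_projection)
  moreover have "\<tau> q = \<tau> (q - p) + \<tau> p"
    using trace_add[OF mem p(1)] by simp
  ultimately show ?thesis
    by simp
qed

end

text \<open>A nonzero vector in the ranges of the first two projections has a form under
  \<open>t = s + (t - s)\<close> strictly above \<open>a + b\<close> times its squared norm, so the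
  third projection cannot kill it.\<close>

lemma spectral_projection_product_le:
  assumes s: "selfadjoint s" and t: "selfadjoint t" and commute: "s o\<^sub>L t = t o\<^sub>L s"
  shows "spectral_projection s {a<..} (spectral_below_perp b (t - s) v) =
      spectral_projection t {a + b<..} (spectral_projection s {a<..} (spectral_below_perp b (t - s) v))"
proof -
  define d where "d = t - s"
  define P where "P = spectral_projection s {a<..}"
  define Q where "Q = spectral_below_perp b d"
  define R where "R = spectral_projection t {a + b<..}"
  have d: "selfadjoint d"
    using s t by (simp add: d_def selfadjoint_iff symmetric_op_algebra
        strong_algebra.diff[OF strong_algebra_bounded_operators])
  have s_d: "s o\<^sub>L d = d o\<^sub>L s" and t_d: "t o\<^sub>L d = d o\<^sub>L t"
    using blinfun_compose_eqD[OF commute]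
    by (auto intro!: blinfun_eqI simp: d_def blinfun.diff_left blinfun.diff_right)
  have P_comm: "P o\<^sub>L y = y o\<^sub>L P" if "s o\<^sub>L y = y o\<^sub>L s" for y
    unfolding P_def by (rule spectral_projection_commute[OF s _ that]) simp
  have R_comm: "R o\<^sub>L y = y o\<^sub>L R" if "t o\<^sub>L y = y o\<^sub>L t" for y
    unfolding R_def by (rule spectral_projection_commute[OF t _ that]) simp
  have Q_comm: "Q o\<^sub>L y = y o\<^sub>L Q" if "d o\<^sub>L y = y o\<^sub>L d" for y
    unfolding Q_def by (rule spectral_below_perp_commute[OF d that])
  \<comment> \<open>Commutation is passed on twice: a spectral projection commutes with whatever its
    operator commutes with, in particular with another operator's spectral projection.\<close>
  have QP: "Q (P w) = P (Q w)" and RP: "R (P w) = P (R w)" and RQ: "R (Q w) = Q (R w)" for w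
    using blinfun_compose_eqD[OF Q_comm[OF P_comm[OF s_d, symmetric]]]
      blinfun_compose_eqD[OF R_comm[OF P_comm[OF commute, symmetric]]]
      blinfun_compose_eqD[OF R_comm[OF Q_comm[OF t_d[symmetric], symmetric]]] by simp_all
  have proj: "orthogonal_projection P" "orthogonal_projection R"
    "orthogonal_projection Q"
    using projection_spectral_projection[OF s, of "{a<..}"]
      projection_spectral_projection[OF t, of "{a + b<..}"]
      projection_spectral_below_perp[OF d, of b]
    by (simp_all add: P_def Q_def R_def projection_iff)
  note idem = projection_idem[OF proj(1)] projection_idem[OF proj(2)] projection_idem[OF proj(3)]
  \<comment> \<open>The part of \<open>P (Q v)\<close> outside the range of \<open>R\<close>;
    pairwise commutation keeps it in the ranges of \<open>P\<close> and \<open>Q\<close>.\<close>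
  define u where "u = P (Q v) - R (P (Q v))"
  have "u = 0"
  proof (rule ccontr)
    assume "u \<noteq> 0"
    have "P u = u" "Q u = u" "R u = 0"
      by (simp_all add: u_def blinfun.diff_right idem QP RP RQ)
    then have "a * inner u u < inner u (s u)" "b * inner u u \<le> inner u (d u)"
        "inner u (t u) \<le> (a + b) * inner u u"
      using spectral_projection_greaterThan[OF s, of a u] spectral_below_perp_ge[OF d, of b u]
        spectral_projection_greaterThan_eq_0[OF t, of "a + b" u] \<open>u \<noteq> 0\<close>
      by (simp_all add: P_def Q_def R_def)
    moreover have "inner u (t u) = inner u (s u) + inner u (d u)"
      by (simp add: d_def blinfun.diff_left inner_diff_right)
    ultimately show False
      by (simp add: algebra_simps)
  qed
  then show ?thesis
    by (simp add: u_def P_def Q_def R_def d_def)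
qed

theorem theorem2p8:
  fixes M :: "'h::complex_hilbert_space oper set"
    and \<tau> :: "'h oper \<Rightarrow> complex"
    and x :: "nat \<Rightarrow> 'h oper"
    and n :: nat
    and l \<alpha> :: real
  assumes "tracial_von_neumann_algebra M \<tau>"
    and "1 \<le> n"
    and "\<And>k. k \<in> {1..n} \<Longrightarrow> x k \<in> M \<and> selfadjoint (x k)"
    and "weakly_fully_independent \<tau> n x"
    and "\<And>k. k \<in> {1..n} \<Longrightarrow>
           partial_sum x k o\<^sub>L partial_sum x n = partial_sum x n o\<^sub>L partial_sum x k"
    and "0 < l"
    and "0 < \<alpha>" "\<alpha> < 1"
  shows "\<exists>p \<in> M. projection p \<and>
           Max ((\<lambda>k. 1 / 2 ^ (k - 1) * Re (\<tau> (spectral_projection (partial_sum x k) {l<..}))) ` {1..n})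
             \<le> Re (\<tau> p) \<and>
           ereal (Re (\<tau> p))
             \<le> (if M_const \<tau> n x \<alpha> l = \<infinity> then \<infinity>
                else M_const \<tau> n x \<alpha> l *
                     ereal (Re (\<tau> (spectral_projection (partial_sum x n) {\<alpha> * l<..}))))"
proof -
  interpret tracial_von_neumann_algebra M \<tau>
    by fact
  interpret strong_algebra M
    by (rule strong_algebra)
  define s where "s = partial_sum x"
  define f where "f k = Re (\<tau> (spectral_projection (s k) {l<..}))" for k
  define g where "g k = Re (\<tau> (spectral_below_perp (- ((1 - \<alpha>) * l)) (s n - s k)))" for k
  define m where "m = Min (g ` {1..n})"
  define R where "R = spectral_projection (s n) {\<alpha> * l<..}"
  note x = assms(3)
  have s_sum: "s k = (\<Sum>i\<in>{1..k}. x i)" for k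
    by (simp add: s_def partial_sum_def)
  have s_sa: "selfadjoint (s k)" if "k \<le> n" for k
    unfolding s_sum by (rule selfadjoint_sum) (use x that in auto)
  have s_mem: "s k \<in> M" if "k \<le> n" for k
    using that by (induction k) (use x in \<open>auto simp: s_sum zero add\<close>)
  have diff_sum: "s n - s k = (\<Sum>i\<in>{Suc k..n}. x i)" if "k \<le> n" for k
  proof -
    have "{1..n} = {1..k} \<union> {Suc k..n}" "{1..k} \<inter> {Suc k..n} = {}"
      using that by auto
    then show ?thesis
      by (simp add: s_sum sum.union_disjoint)
  qed
  have diff_sa: "selfadjoint (s n - s k)" if "k \<le> n" for k
    unfolding diff_sum[OF that] by (rule selfadjoint_sum) (use x in auto)
  have P: "spectral_projection (s k) {l<..} \<in> M" "projection (spectral_projection (s k) {l<..})"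
    if "k \<le> n" for k
    using s_sa[OF that] s_mem[OF that]
    by (auto intro: spectral_projection_mem projection_spectral_projection strong_algebra_axioms)
  have Q: "spectral_below_perp t (s n - s k) \<in> M" "projection (spectral_below_perp t (s n - s k))"
    if "k \<le> n" for k t
  proof -
    have "s n - s k \<in> M"
      using that by (simp add: diff s_mem)
    with diff_sa[OF that] have "spectral_projection (s n - s k) {..<t} \<in> M"
      by (intro spectral_projection_mem strong_algebra_axioms) simp_all
    then show "spectral_below_perp t (s n - s k) \<in> M"
      unfolding spectral_below_perp_def spectral_below_def by (intro diff one)
    show "projection (spectral_below_perp t (s n - s k))"
      by (intro projection_spectral_below_perp diff_sa that)
  qed
  have R: "R \<in> M" "projection R"
    using s_sa[OF order_refl] s_mem[OF order_refl]
    by (auto simp: R_def intro: spectral_projection_mem projection_spectral_projection strong_algebra_axioms)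
  have f_nonneg: "0 \<le> f k" if "k \<le> n" for k
    unfolding f_def by (intro trace_projection P that)
  have g_nonneg: "0 \<le> g k" if "k \<le> n" for k
    unfolding g_def by (intro trace_projection Q that)
  have m_le: "m \<le> g k" if "k \<in> {1..n}" for k
    using that by (simp add: m_def)
  have m_nonneg: "0 \<le> m"
    unfolding m_def using \<open>1 \<le> n\<close> g_nonneg by (intro Min.boundedI) auto
  have key: "f k * m \<le> Re (\<tau> R)" if k: "k \<in> {1..n}" for k
  proof (cases "k = n")
    case True
    \<comment> \<open>Independence offers no split after the last index. The trace of a projection
      is at most one, hence \<open>m \<le> 1\<close>, and monotonicity in the threshold does the
      rest.\<close>
    have "Re (\<tau> (spectral_below_perp t (s n - s n))) \<le> Re (\<tau> id_blinfun)" for t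
      using projection_complement[of 0] subset_bounded_operators one
      by (intro trace_projection_mono Q one)
        (auto simp: projection_iff orthogonal_projection_def symmetric_op_algebra)
    then have "m \<le> 1"
      using m_le[OF k] True by (simp add: g_def trace_one) (meson order_trans)
    then have "f k * m \<le> f k * 1"
      using k by (intro mult_left_mono f_nonneg) auto
    also have "f k \<le> Re (\<tau> R)"
      unfolding f_def
    proof (intro trace_projection_mono P R)
      have "\<alpha> * l \<le> l"
        using assms(6,8) by simp
      then have "{\<alpha> * l<..} \<inter> {l<..} = {l<..}"
        by auto
      then show "R (spectral_projection (s k) {l<..} v) = spectral_projection (s k) {l<..} v" for v
        unfolding R_def True by (subst spectral_projection_Int) (simp_all add: s_sa)
    qed (use k in auto)
    finally show ?thesis
      by simp
  next
    case False
    then have "k < n" "1 \<le> k"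
      using k by auto
    define P' where "P' = spectral_projection (s k) {l<..}"
    define Q' where "Q' = spectral_below_perp (- ((1 - \<alpha>) * l)) (s n - s k)"
    have P': "P' \<in> M" "projection P'" and Q': "Q' \<in> M" "projection Q'"
      unfolding P'_def Q'_def using \<open>k < n\<close> by (intro P Q; simp)+
    have comm: "s k o\<^sub>L s n = s n o\<^sub>L s k"
      using assms(5)[OF k] by (simp add: s_def)
    have "P' \<in> W* (x ` {1..k})"
      unfolding P'_def using s_sa[of k] \<open>k < n\<close> unfolding s_sum
      by (intro spectral_projection_generated) auto
    moreover have "Q' \<in> W* (x ` {Suc k..n})"
      unfolding Q'_def spectral_below_perp_def spectral_below_def
      using diff_sa[of k] \<open>k < n\<close> unfolding diff_sum[OF less_imp_le[OF \<open>k < n\<close>]]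
      by (intro id_diff_generated spectral_projection_generated) auto
    ultimately have "\<tau> (P' o\<^sub>L Q') = \<tau> P' * \<tau> Q'"
      using assms(4) \<open>k < n\<close> \<open>1 \<le> k\<close> unfolding weakly_fully_independent_def
      \<comment> \<open>The split index \<open>Suc k\<close> separates the variables of
        \<open>s k\<close> from those of \<open>s n - s k\<close>; it is admissible because
        \<open>1 \<le> k < n\<close>.\<close>
      by (elim allE[of _ "Suc k"]) auto
    also have "\<dots> = complex_of_real (f k) * complex_of_real (g k)"
      using trace_projection(1)[OF P'] trace_projection(1)[OF Q']
      by (simp add: f_def g_def P'_def Q'_def)
    finally have trace: "Re (\<tau> (P' o\<^sub>L Q')) = f k * g k"
      by simp
    have "s k o\<^sub>L (s n - s k) = (s n - s k) o\<^sub>L s k"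
      using blinfun_compose_eqD[OF comm]
      by (intro blinfun_eqI) (simp add: blinfun.diff_left blinfun.diff_right)
    then have "P' o\<^sub>L (s n - s k) = (s n - s k) o\<^sub>L P'"
      unfolding P'_def using \<open>k < n\<close> by (intro spectral_projection_commute s_sa) auto
    then have "Q' o\<^sub>L P' = P' o\<^sub>L Q'"
      unfolding Q'_def using \<open>k < n\<close> by (intro spectral_below_perp_commute diff_sa) auto
    then have "orthogonal_projection (P' o\<^sub>L Q')"
      using P' Q' by (intro projection_compose) (auto simp: projection_iff)
    moreover have mem: "P' o\<^sub>L Q' \<in> M"
      by (intro compose P' Q')
    ultimately have "projection (P' o\<^sub>L Q')"
      using subset_bounded_operators by (auto simp: projection_iff)
    \<comment> \<open>The two thresholds in the statement are chosen to add up to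
      \<open>\<alpha> * l\<close>.\<close>
    moreover have "l + - ((1 - \<alpha>) * l) = \<alpha> * l"
      by (simp add: algebra_simps)
    then have "R (P' (Q' v)) = P' (Q' v)" for v
      using spectral_projection_product_le[OF s_sa s_sa comm, of l "- ((1 - \<alpha>) * l)" v] \<open>k < n\<close>
      by (simp add: R_def P'_def Q'_def)
    ultimately have "Re (\<tau> (P' o\<^sub>L Q')) \<le> Re (\<tau> R)"
      by (intro trace_projection_mono mem R) auto
    moreover have "f k * m \<le> f k * g k"
      using k by (intro mult_left_mono m_le f_nonneg) auto
    ultimately show ?thesis
      by (simp add: trace)
  qed
  have "Max (f ` {1..n}) \<in> f ` {1..n}"
    using \<open>1 \<le> n\<close> by (intro Max_in) auto
  then obtain k where k: "k \<in> {1..n}" and "f k = Max (f ` {1..n})"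
    by auto
  then have f_le: "f j \<le> f k" if "j \<in> {1..n}" for j
    using that by simp
  have "1 / 2 ^ (j - 1) * f j \<le> f k" if "j \<in> {1..n}" for j
  proof -
    \<comment> \<open>The weights are at most one and the traces nonnegative, so the weighted
      maximum is below the plain one.\<close>
    have "1 / 2 ^ (j - 1) * f j \<le> 1 * f j"
      using that by (intro mult_right_mono f_nonneg) (auto simp: divide_le_eq_1)
    then show ?thesis
      using f_le[OF that] by simp
  qed
  then have "Max ((\<lambda>j. 1 / 2 ^ (j - 1) * f j) ` {1..n}) \<le> f k"
    using \<open>1 \<le> n\<close> by (intro Max.boundedI) auto
  moreover have M_const: "M_const \<tau> n x \<alpha> l = 1 / ereal m"
    by (simp add: M_const_def m_def g_def s_def)
  have "ereal (f k) \<le> (if M_const \<tau> n x \<alpha> l = \<infinity> then \<infinity> else M_const \<tau> n x \<alpha> l * ereal (Re (\<tau> R)))"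
  \<comment> \<open>For \<open>m = 0\<close> extended division makes \<open>M_const\<close> infinite
    and the bound trivial; otherwise \<open>key\<close> may be divided by \<open>m\<close>.\<close>
  proof (cases "m = 0")
    case False
    then have "0 < m"
      using m_nonneg by simp
    then have "f k \<le> 1 / m * Re (\<tau> R)"
      using key[OF k] by (simp add: field_simps)
    then show ?thesis
      using \<open>0 < m\<close> by (simp add: M_const one_ereal_def)
  qed (simp add: M_const)
  ultimately show ?thesis
    using P[of k] k unfolding f_def R_def s_def
    by (intro bexI[of _ "spectral_projection (partial_sum x k) {l<..}"]) auto
qed

end
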